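(* Let $t\in\mathbb{R}$. The functional $\mathcal{C}^1\to\mathbb{R}$, $u\mapsto V_1(\mathrm{cl}(\{\hat u<t\}))$, where $\hat u(x,y)=u(x)+|y|$ for $(x,y)\in\mathbb{R}\times\mathbb{R}$, is a rigid motion invariant, decreasing and m-continuous valuation on $\mathcal{C}^1$, but it cannot be written as a finite sum of functionals on $\mathcal{C}^1$ each of which is $\alpha$-homogeneous for some $\alpha\in\mathbb{R}$.
   Context: For $n\ge1$, $\mathcal{C}^n$ is the set of all convex, lower semi-continuous functions $u:\mathbb{R}^n\to\mathbb{R}\cup\{\infty\}$ with $\lim_{|x|\to\infty}u(x)=\infty$; it contains the function $\boldsymbol{\infty}$ identically equal to $\infty$. $\mathrm{dom}(u)=\{x: u(x)<\infty\}$. $u\vee v$ and $u\wedge v$ denote pointwise maximum and minimum. A valuation on $\mathcal{C}^n$ is a map $\mu:\mathcal{C}^n\to\mathbb{R}$ with $\mu(\boldsymbol{\infty})=0$ and $\mu(u\vee v)+\mu(u\wedge v)=\mu(u)+\mu(v)$ for all $u,v\in\mathcal{C}^n$ such that $u\wedge v\in\mathcal{C}^n$. It is rigid motion invariant if $\mu(u\circ T)=\mu(u)$ for all $u$ and all rigid motions $T$ (maps $T(x)=Rx+x_0$, $R\in\mathbf{O}(n)$); decreasing if $\mu(u)\le\mu(v)$ whenever $u\ge v$ pointwise; m-continuous if $\mu(u_i)\to\mu(u)$ whenever $u,u_i\in\mathcal{C}^n$, $u_i\ge u_{i+1}\ge u$ in $\mathbb{R}^n$ for every $i$ and $u_i\to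 u$ pointwise in the relative interior of $\mathrm{dom}(u)$. A functional $F:\mathcal{C}^n\to\mathbb{R}$ is $\alpha$-homogeneous if $F(u_\lambda)=\lambda^\alpha F(u)$ for all $u\in\mathcal{C}^n$ and $\lambda>0$, where $u_\lambda(x)=u(x/\lambda)$. $V_1$ is the first intrinsic volume of compact convex subsets of $\mathbb{R}^2$ (length for one-dimensional sets, half of the perimeter for two-dimensional sets, $V_1(\emptyset)=0$); $\mathrm{cl}$ denotes closure; $\hat u\in\mathcal{C}^2$ whenever $u\in\mathcal{C}^1$. *)

theory Defs
  imports "HOL-Analysis.Analysis"
begin

text \<open>The space \<open>\<C>\<^sup>n\<close>, with \<open>\<real>\<^sup>n\<close> an arbitrary Euclidean space; below, \<open>\<real>\<^sup>1\<close> is the type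
  \<open>real\<close> and \<open>\<real>\<^sup>2\<close> is \<open>real \<times> real\<close> (whose norm is the Euclidean one).
  Since \<open>u\<close> omits the value \<open>- \<infinity>\<close> and \<open>0 * \<infinity> = 0\<close> in \<open>ereal\<close>, no indeterminate sums occur in
  the convexity inequality.\<close>

definition convex_fun :: "('a::real_vector \<Rightarrow> ereal) \<Rightarrow> bool" where
  "convex_fun u \<longleftrightarrow>
     (\<forall>x y. \<forall>a\<ge>0. \<forall>b\<ge>0. a + b = 1 \<longrightarrow>
        u (a *\<^sub>R x + b *\<^sub>R y) \<le> ereal a * u x + ereal b * u y)"

definition lower_semicontinuous :: "('a::topological_space \<Rightarrow> ereal) \<Rightarrow> bool" where
  "lower_semicontinuous u \<longleftrightarrow> (\<forall>x. u x \<le> Liminf (at x) u)"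

definition coercive_convex :: "('a::euclidean_space \<Rightarrow> ereal) set" where
  "coercive_convex =
     {u. (\<forall>x. u x \<noteq> -\<infinity>) \<and> convex_fun u \<and> lower_semicontinuous u \<and>
         (u \<longlongrightarrow> \<infinity>) at_infinity}"

definition eff_dom :: "('a \<Rightarrow> ereal) \<Rightarrow> 'a set" where
  "eff_dom u = {x. u x < \<infinity>}"

text \<open>Functionals on \<open>\<C>\<^sup>n\<close> are represented by total functions of which only the values on
  \<open>coercive_convex\<close> matter.\<close>

definition valuation :: "(('a::euclidean_space \<Rightarrow> ereal) \<Rightarrow> real) \<Rightarrow> bool" where
  "valuation \<mu> \<longleftrightarrow>
     \<mu> (\<lambda>_. \<infinity>) = 0 \<and>
     (\<forall>u\<in>coercive_convex. \<forall>v\<in>coercive_convex.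
        (\<lambda>x. min (u x) (v x)) \<in> coercive_convex \<longrightarrow>
        \<mu> (\<lambda>x. max (u x) (v x)) + \<mu> (\<lambda>x. min (u x) (v x)) = \<mu> u + \<mu> v)"

definition rigid_motion :: "('a::euclidean_space \<Rightarrow> 'a) \<Rightarrow> bool" where
  "rigid_motion T \<longleftrightarrow>
     (\<exists>R x0. orthogonal_transformation R \<and> (\<forall>x. T x = R x + x0))"

definition rigid_motion_invariant :: "(('a::euclidean_space \<Rightarrow> ereal) \<Rightarrow> real) \<Rightarrow> bool" where
  "rigid_motion_invariant \<mu> \<longleftrightarrow>
     (\<forall>u\<in>coercive_convex. \<forall>T. rigid_motion T \<longrightarrow> \<mu> (u \<circ> T) = \<mu> u)"

definition decreasing_functional :: "(('a::euclidean_space \<Rightarrow> ereal) \<Rightarrow> real) \<Rightarrow> bool" where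
  "decreasing_functional \<mu> \<longleftrightarrow>
     (\<forall>u\<in>coercive_convex. \<forall>v\<in>coercive_convex. (\<forall>x. u x \<ge> v x) \<longrightarrow> \<mu> u \<le> \<mu> v)"

definition m_continuous :: "(('a::euclidean_space \<Rightarrow> ereal) \<Rightarrow> real) \<Rightarrow> bool" where
  "m_continuous \<mu> \<longleftrightarrow>
     (\<forall>u\<in>coercive_convex. \<forall>U :: nat \<Rightarrow> 'a \<Rightarrow> ereal.
        (\<forall>i. U i \<in> coercive_convex) \<longrightarrow>
        (\<forall>i x. U i x \<ge> U (Suc i) x \<and> U (Suc i) x \<ge> u x) \<longrightarrow>
        (\<forall>x\<in>rel_interior (eff_dom u). (\<lambda>i. U i x) \<longlonglongrightarrow> u x) \<longrightarrow>
        (\<lambda>i. \<mu> (U i)) \<longlonglongrightarrow> \<mu> u)"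

definition homogeneous_functional ::
    "real \<Rightarrow> (('a::euclidean_space \<Rightarrow> ereal) \<Rightarrow> real) \<Rightarrow> bool" where
  "homogeneous_functional \<alpha> F \<longleftrightarrow>
     (\<forall>u\<in>coercive_convex. \<forall>l>0. F (\<lambda>x. u (x /\<^sub>R l)) = l powr \<alpha> * F u)"

text \<open>Length of curves and of boundaries is measured by the one-dimensional Hausdorff (outer)
  measure. The covering sets are required to be bounded because \<open>diameter\<close> is
  unspecified on unbounded sets.\<close>

definition hausdorff_premeasure1 :: "real \<Rightarrow> 'a::metric_space set \<Rightarrow> ennreal" where
  "hausdorff_premeasure1 \<delta> A =
     (INF U \<in> {U :: nat \<Rightarrow> 'a set. A \<subseteq> (\<Union>i. U i) \<and> (\<forall>i. bounded (U i) \<and> diameter (U i) \<le> \<delta>)}.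
        \<Sum>i. ennreal (diameter (U i)))"

definition hausdorff_measure1 :: "'a::metric_space set \<Rightarrow> ennreal" where
  "hausdorff_measure1 A = (SUP \<delta>\<in>{0<..}. hausdorff_premeasure1 \<delta> A)"

definition curve_length :: "'a::metric_space set \<Rightarrow> real" where
  "curve_length A = enn2real (hausdorff_measure1 A)"

definition perimeter :: "(real \<times> real) set \<Rightarrow> real" where
  "perimeter K = curve_length (frontier K)"

text \<open>The first intrinsic volume of a compact convex set in the plane; it vanishes on singletons
  and on the empty set (\<open>aff_dim\<close> equal to \<open>0\<close> or \<open>- 1\<close>).\<close>

definition intrinsic_volume1 :: "(real \<times> real) set \<Rightarrow> real" where
  "intrinsic_volume1 K =
     (if aff_dim K = 2 then perimeter K / 2
      else if aff_dim K = 1 then curve_length K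
      else 0)"

definition hat :: "(real \<Rightarrow> ereal) \<Rightarrow> real \<times> real \<Rightarrow> ereal" where
  "hat u = (\<lambda>(x, y). u x + ereal \<bar>y\<bar>)"

definition level_V1 :: "real \<Rightarrow> (real \<Rightarrow> ereal) \<Rightarrow> real" where
  "level_V1 t u = intrinsic_volume1 (closure {p. hat u p < ereal t})"

end

theory Submission
  imports Defs "HOL-Complex_Analysis.Conformal_Mappings"
begin

text \<open>Let \<open>K\<^sub>u\<close> be the closure of \<open>{hat u < t}\<close>, a planar convex body. The nearest-point map is
  1-Lipschitz, so perimeters increase with the body, and they scale like lengths. Continuity follows:
  along a decreasing sequence \<open>U\<^sub>i\<close>, every copy of \<open>K\<^sub>u\<close> shrunk by a factor \<open>1 - \<epsilon>\<close> is
  eventually contained in the body of \<open>U\<^sub>i\<close>. When \<open>min u v\<close> is in \<open>\<C>\<^sup>1\<close>, the bodies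
  of minimum and maximum are the union and the intersection of \<open>K\<^sub>u\<close> and \<open>K\<^sub>v\<close>, and the valuation
  property reduces to additivity of the Hausdorff measure of frontiers. For
  \<open>u x = \<bar>x\<bar> + t - 1\<close> the body of the dilate \<open>u\<^sub>\<lambda>\<close> is a rhombus, and its half-perimeter
  \<open>2 sqrt (1 + \<lambda>\<^sup>2)\<close> is not a finite sum of powers of \<open>\<lambda>\<close>.\<close>

section \<open>One-dimensional Hausdorff measure\<close>

text \<open>The obstacle is degeneracy. \<open>intrinsic_volume1\<close> is half a perimeter for
  bodies with interior but a full length for segments, and monotonicity and additivity have to
  survive the passage from one to the other. Counting thin bodies twice removes the distinction, at
  the price of two critical configurations: a segment inside a body with interior, and two bodies
  with disjoint nonempty interiors. In the second one the common segment lies on both frontiers and,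
  up to its endpoints, not on the frontier of the union, so exactly twice its length is lost.
  Continuity has a degenerate case as well. Convergence is assumed only in the relative interior of
  the domain, which says nothing about its end points; but a nonempty thin body forces the domain to
  be a single point, and there convergence is available. In the last part the square root is never
  continued itself: squaring turns the alleged identity into one between entire functions, and the
  square of an entire function has no simple zeros.\<close>

lemma diameter_leI:
  fixes S :: "'a::metric_space set"
  assumes "0 \<le> d" "\<And>x y. x \<in> S \<Longrightarrow> y \<in> S \<Longrightarrow> dist x y \<le> d"
  shows "diameter S \<le> d"
  using assms by (auto simp: diameter_def intro: cSUP_least)

lemma hausdorff_premeasure1_le:
  assumes "A \<subseteq> (\<Union>i. U i)" "\<And>i. bounded (U i)" "\<And>i. diameter (U i) \<le> \<delta>"
  shows "hausdorff_premeasure1 \<delta> A \<le> (\<Sum>i. ennreal (diameter (U i)))"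
  unfolding hausdorff_premeasure1_def using assms by (intro INF_lower) auto

lemma hausdorff_premeasure1_mono:
  assumes "A \<subseteq> B" "\<delta>' \<le> \<delta>"
  shows "hausdorff_premeasure1 \<delta> A \<le> hausdorff_premeasure1 \<delta>' B"
  unfolding hausdorff_premeasure1_def
proof (rule INF_superset_mono)
  show "{U :: nat \<Rightarrow> 'a set. B \<subseteq> (\<Union>i. U i) \<and> (\<forall>i. bounded (U i) \<and> diameter (U i) \<le> \<delta>')}
      \<subseteq> {U. A \<subseteq> (\<Union>i. U i) \<and> (\<forall>i. bounded (U i) \<and> diameter (U i) \<le> \<delta>)}"
    using assms order_trans by blast
qed simp

lemma hausdorff_premeasure1_UN:
  "hausdorff_premeasure1 \<delta> (\<Union>n. A n) \<le> (\<Sum>n. hausdorff_premeasure1 \<delta> (A n))"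
proof (rule ennreal_le_epsilon)
  fix e :: real
  assume fin: "(\<Sum>n. hausdorff_premeasure1 \<delta> (A n)) < top" and e: "0 < e"
  have "\<exists>U. A n \<subseteq> (\<Union>i. U i) \<and> (\<forall>i. bounded (U i) \<and> diameter (U i) \<le> \<delta>) \<and>
      (\<Sum>i. ennreal (diameter (U i))) \<le> hausdorff_premeasure1 \<delta> (A n) + ennreal (e * (1/2) ^ Suc n)" for n
  proof -
    have "hausdorff_premeasure1 \<delta> (A n) \<noteq> \<infinity>"
      using ennreal_suminf_lessD[OF fin, of n] by auto
    from INF_approx_ennreal[OF _ hausdorff_premeasure1_def this, of "e * (1/2) ^ Suc n"] e
    obtain U where "U \<in> {U. A n \<subseteq> (\<Union>i. U i) \<and> (\<forall>i. bounded (U i) \<and> diameter (U i) \<le> \<delta>)}"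
      "(\<Sum>i. ennreal (diameter (U i))) < hausdorff_premeasure1 \<delta> (A n) + ennreal (e * (1/2) ^ Suc n)"
      by auto
    then show ?thesis by (intro exI[of _ U]) auto
  qed
  then obtain U where U: "\<And>n. A n \<subseteq> (\<Union>i. U n i)" "\<And>n i. bounded (U n i)"
      "\<And>n i. diameter (U n i) \<le> \<delta>"
      "\<And>n. (\<Sum>i. ennreal (diameter (U n i))) \<le> hausdorff_premeasure1 \<delta> (A n) + ennreal (e * (1/2) ^ Suc n)"
    by metis
  define W where "W = (\<lambda>(n, i). U n i)"
  have "hausdorff_premeasure1 \<delta> (\<Union>n. A n) \<le> (\<Sum>k. ennreal (diameter (W (prod_decode k))))"
  proof (rule hausdorff_premeasure1_le)
    show "(\<Union>n. A n) \<subseteq> (\<Union>k. W (prod_decode k))"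
    proof
      fix x assume "x \<in> (\<Union>n. A n)"
      then obtain n i where "x \<in> U n i" using U(1) by blast
      then have "x \<in> W (prod_decode (prod_encode (n, i)))" by (simp add: W_def)
      then show "x \<in> (\<Union>k. W (prod_decode k))" by blast
    qed
  qed (auto simp: W_def U split: prod.splits)
  also have "\<dots> = (\<Sum>n. \<Sum>i. ennreal (diameter (U n i)))"
    by (subst suminf_ennreal_2dimen[of _ "\<lambda>p. ennreal (diameter (W p))"]) (auto simp: W_def)
  also have "\<dots> \<le> (\<Sum>n. hausdorff_premeasure1 \<delta> (A n) + ennreal (e * (1/2) ^ Suc n))"
    by (intro suminf_le U(4) summableI)
  also have "\<dots> = (\<Sum>n. hausdorff_premeasure1 \<delta> (A n)) + (\<Sum>n. ennreal (e * (1/2) ^ Suc n))"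
    by (rule suminf_add[symmetric]) auto
  also have "(\<lambda>n. ennreal (e * (1/2) ^ Suc n)) sums ennreal (e * 1)"
    using e sums_mult[OF power_half_series, of e] by (subst sums_ennreal) (auto simp del: power_Suc)
  then have "(\<Sum>n. ennreal (e * (1/2) ^ Suc n)) = ennreal e"
    by (simp add: sums_unique[symmetric])
  finally show "hausdorff_premeasure1 \<delta> (\<Union>n. A n)
      \<le> (\<Sum>n. hausdorff_premeasure1 \<delta> (A n)) + ennreal e" .
qed

lemma hausdorff_premeasure1_le_measure:
  "0 < \<delta> \<Longrightarrow> hausdorff_premeasure1 \<delta> A \<le> hausdorff_measure1 A"
  unfolding hausdorff_measure1_def by (rule SUP_upper) auto

lemma hausdorff_measure1_mono: "A \<subseteq> B \<Longrightarrow> hausdorff_measure1 A \<le> hausdorff_measure1 B"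
  unfolding hausdorff_measure1_def by (intro SUP_mono) (auto intro: hausdorff_premeasure1_mono)

lemma hausdorff_measure1_UN: "hausdorff_measure1 (\<Union>n. A n) \<le> (\<Sum>n. hausdorff_measure1 (A n))"
  unfolding hausdorff_measure1_def[of "\<Union>n. A n"]
proof (rule SUP_least)
  fix \<delta> :: real assume "\<delta> \<in> {0<..}"
  then show "hausdorff_premeasure1 \<delta> (\<Union>n. A n) \<le> (\<Sum>n. hausdorff_measure1 (A n))"
    by (intro order_trans[OF hausdorff_premeasure1_UN] suminf_le)
      (auto intro: hausdorff_premeasure1_le_measure)
qed

lemma hausdorff_measure1_singleton [simp]: "hausdorff_measure1 {x} = 0"
proof -
  have "hausdorff_premeasure1 \<delta> {x} \<le> 0" if "0 < \<delta>" for \<delta> :: real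
    using hausdorff_premeasure1_le[of "{x}" "\<lambda>_. {x}" \<delta>] that by simp
  then show ?thesis unfolding hausdorff_measure1_def by (simp add: SUP_eq_iff bot_ennreal)
qed

lemma hausdorff_measure1_empty [simp]: "hausdorff_measure1 {} = 0"
  using hausdorff_measure1_mono[of "{}" "{undefined}"] by simp

lemma hausdorff_measure1_Un: "hausdorff_measure1 (A \<union> B) \<le> hausdorff_measure1 A + hausdorff_measure1 B"
  using hausdorff_measure1_UN[of "binaryset A B"]
  by (simp add: UN_binaryset_eq suminf_binaryset_eq)

lemma hausdorff_measure1_finite: "finite A \<Longrightarrow> hausdorff_measure1 A = 0"
proof (induction A rule: finite_induct)
  case (insert x F)
  then show ?case using hausdorff_measure1_Un[of "{x}" F] by simp
qed simp

text \<open>A cover of \<open>A\<close> at scale \<open>\<delta> / L\<close> is pushed forward to a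
  cover of the image at scale \<open>\<delta>\<close>; its members are first intersected with
  \<open>A\<close>, since \<open>f\<close> is controlled only there. Dividing by \<open>L\<close>
  leaves a bare infimum on the right, so each cover can be treated separately.\<close>

lemma hausdorff_measure1_lipschitz_image:
  assumes L: "0 < L" and f: "\<And>x y. x \<in> A \<Longrightarrow> y \<in> A \<Longrightarrow> dist (f x) (f y) \<le> L * dist x y"
  shows "hausdorff_measure1 (f ` A) \<le> ennreal L * hausdorff_measure1 A"
  unfolding hausdorff_measure1_def[of "f ` A"]
proof (rule SUP_least)
  fix \<delta> :: real assume "\<delta> \<in> {0<..}"
  then have \<delta>: "0 < \<delta> / L" using L by simp
  have L': "ennreal L * (x / ennreal L) = x" for x
    using L by (simp add: ennreal_times_divide mult.commute[of "ennreal L"] mult_divide_eq_ennreal)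
  have "hausdorff_premeasure1 \<delta> (f ` A) / ennreal L \<le> hausdorff_premeasure1 (\<delta> / L) A"
    unfolding hausdorff_premeasure1_def[of "\<delta> / L"]
  proof (rule INF_greatest)
    fix U :: "nat \<Rightarrow> 'a set"
    assume "U \<in> {U. A \<subseteq> (\<Union>i. U i) \<and> (\<forall>i. bounded (U i) \<and> diameter (U i) \<le> \<delta> / L)}"
    then have U: "A \<subseteq> (\<Union>i. U i)" "\<And>i. bounded (U i)" "\<And>i. diameter (U i) \<le> \<delta> / L" by auto
    have d: "dist y z \<le> L * diameter (U i)" if "y \<in> f ` (U i \<inter> A)" "z \<in> f ` (U i \<inter> A)" for i y z
    proof -
      obtain a b where ab: "a \<in> U i" "a \<in> A" "b \<in> U i" "b \<in> A" "y = f a" "z = f b"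
        using \<open>y \<in> f ` (U i \<inter> A)\<close> \<open>z \<in> f ` (U i \<inter> A)\<close> by auto
      then have "dist y z \<le> L * dist a b" using f by auto
      also have "\<dots> \<le> L * diameter (U i)"
        using L ab U(2) by (intro mult_left_mono diameter_bounded_bound) auto
      finally show ?thesis .
    qed
    have dm: "diameter (f ` (U i \<inter> A)) \<le> L * diameter (U i)" for i
      using L d by (intro diameter_leI) (auto intro!: mult_nonneg_nonneg diameter_ge_0 U(2))
    have bd: "bounded (f ` (U i \<inter> A))" for i
      using d bounded_two_points by meson
    have "hausdorff_premeasure1 \<delta> (f ` A) \<le> (\<Sum>i. ennreal (diameter (f ` (U i \<inter> A))))"
    proof (rule hausdorff_premeasure1_le[OF _ bd])
      show "f ` A \<subseteq> (\<Union>i. f ` (U i \<inter> A))" using U(1) by blast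
      show "diameter (f ` (U i \<inter> A)) \<le> \<delta>" for i
        using dm[of i] U(3)[of i] L by (simp add: field_simps)
    qed
    also have "\<dots> \<le> (\<Sum>i. ennreal L * ennreal (diameter (U i)))"
      using dm L by (intro suminf_le summableI) (simp add: ennreal_mult'[symmetric] ennreal_leI)
    finally have "hausdorff_premeasure1 \<delta> (f ` A) \<le> ennreal L * (\<Sum>i. ennreal (diameter (U i)))"
      by simp
    then have "hausdorff_premeasure1 \<delta> (f ` A) / ennreal L
        \<le> (ennreal L * (\<Sum>i. ennreal (diameter (U i)))) / ennreal L"
      by (rule divide_right_mono_ennreal)
    then show "hausdorff_premeasure1 \<delta> (f ` A) / ennreal L \<le> (\<Sum>i. ennreal (diameter (U i)))"
      using L' by (simp add: ennreal_times_divide)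
  qed
  also have "\<dots> \<le> hausdorff_measure1 A" by (rule hausdorff_premeasure1_le_measure[OF \<delta>])
  finally have "ennreal L * (hausdorff_premeasure1 \<delta> (f ` A) / ennreal L)
      \<le> ennreal L * hausdorff_measure1 A"
    by (rule mult_left_mono) simp
  then show "hausdorff_premeasure1 \<delta> (f ` A) \<le> ennreal L * hausdorff_measure1 A"
    unfolding L' .
qed

text \<open>Below scale \<open>d\<close> no covering set meets both \<open>A\<close> and
  \<open>B\<close>, so every cover splits in two. Small scales determine the supremum because
  premeasures grow as the scale shrinks.\<close>

lemma hausdorff_measure1_separated:
  assumes d: "0 < d" and sep: "\<And>x y. x \<in> A \<Longrightarrow> y \<in> B \<Longrightarrow> d \<le> dist x y"
  shows "hausdorff_measure1 A + hausdorff_measure1 B \<le> hausdorff_measure1 (A \<union> B)"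
proof -
  have split: "hausdorff_premeasure1 \<delta> A + hausdorff_premeasure1 \<delta> B \<le> hausdorff_premeasure1 \<delta> (A \<union> B)"
    if \<delta>: "0 < \<delta>" "\<delta> < d" for \<delta>
    unfolding hausdorff_premeasure1_def[of \<delta> "A \<union> B"]
  proof (rule INF_greatest)
    fix U :: "nat \<Rightarrow> 'a set"
    assume "U \<in> {U. A \<union> B \<subseteq> (\<Union>i. U i) \<and> (\<forall>i. bounded (U i) \<and> diameter (U i) \<le> \<delta>)}"
    then have U: "A \<union> B \<subseteq> (\<Union>i. U i)" "\<And>i. bounded (U i)" "\<And>i. diameter (U i) \<le> \<delta>" by auto
    \<comment> \<open>Discarded members become empty instead of being removed: the family stays
      indexed by \<open>nat\<close>, and the empty set has diameter 0.\<close>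
    define P where "P X i = (if U i \<inter> X = {} then {} else U i)" for X i
    have *: "hausdorff_premeasure1 \<delta> X \<le> (\<Sum>i. ennreal (diameter (P X i)))" if XAB: "X \<subseteq> A \<union> B" for X
    proof (rule hausdorff_premeasure1_le)
      show "X \<subseteq> (\<Union>i. P X i)"
      proof
        fix x assume "x \<in> X"
        moreover from this obtain i where "x \<in> U i" using U(1) XAB by blast
        ultimately have "x \<in> P X i" by (auto simp: P_def)
        then show "x \<in> (\<Union>i. P X i)" by blast
      qed
    qed (use U \<delta> in \<open>auto simp: P_def\<close>)
    have disj: "U i \<inter> A = {} \<or> U i \<inter> B = {}" for i
    proof (rule ccontr)
      assume "\<not> ?thesis"
      then obtain x y where "x \<in> U i" "x \<in> A" "y \<in> U i" "y \<in> B" by auto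
      then show False
        using sep[of x y] diameter_bounded_bound[OF U(2)[of i], of x y] U(3)[of i] \<delta> by simp
    qed
    have "hausdorff_premeasure1 \<delta> A + hausdorff_premeasure1 \<delta> B
        \<le> (\<Sum>i. ennreal (diameter (P A i))) + (\<Sum>i. ennreal (diameter (P B i)))"
      by (intro add_mono *) auto
    also have "\<dots> = (\<Sum>i. ennreal (diameter (P A i)) + ennreal (diameter (P B i)))"
      by (intro suminf_add) auto
    also have "\<dots> \<le> (\<Sum>i. ennreal (diameter (U i)))"
      using disj by (intro suminf_le summableI) (auto simp: P_def)
    finally show "hausdorff_premeasure1 \<delta> A + hausdorff_premeasure1 \<delta> B
        \<le> (\<Sum>i. ennreal (diameter (U i)))" .
  qed
  have "hausdorff_measure1 A + hausdorff_measure1 B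
      = (SUP \<delta>\<in>{0<..}. hausdorff_premeasure1 \<delta> A + hausdorff_premeasure1 \<delta> B)"
    unfolding hausdorff_measure1_def
  proof (rule SUP_add_directed_ennreal[symmetric])
    fix i j :: real assume "i \<in> {0<..}" "j \<in> {0<..}"
    then show "\<exists>k\<in>{0<..}. hausdorff_premeasure1 i A + hausdorff_premeasure1 j B
        \<le> hausdorff_premeasure1 k A + hausdorff_premeasure1 k B"
      by (intro bexI[of _ "min i j"] add_mono hausdorff_premeasure1_mono) auto
  qed
  also have "\<dots> \<le> hausdorff_measure1 (A \<union> B)"
  proof (rule SUP_least)
    fix \<delta> :: real assume "\<delta> \<in> {0<..}"
    then have \<delta>: "0 < min \<delta> (d / 2)" "min \<delta> (d / 2) < d" using d by auto
    have "hausdorff_premeasure1 \<delta> A + hausdorff_premeasure1 \<delta> B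
        \<le> hausdorff_premeasure1 (min \<delta> (d / 2)) A + hausdorff_premeasure1 (min \<delta> (d / 2)) B"
      by (intro add_mono hausdorff_premeasure1_mono) auto
    also have "\<dots> \<le> hausdorff_premeasure1 (min \<delta> (d / 2)) (A \<union> B)" by (rule split[OF \<delta>])
    also have "\<dots> \<le> hausdorff_measure1 (A \<union> B)" by (rule hausdorff_premeasure1_le_measure[OF \<delta>(1)])
    finally show "hausdorff_premeasure1 \<delta> A + hausdorff_premeasure1 \<delta> B \<le> hausdorff_measure1 (A \<union> B)" .
  qed
  finally show ?thesis .
qed

section \<open>Additivity along closed sets\<close>

lemma sum_even_odd:
  fixes f :: "nat \<Rightarrow> 'a::comm_monoid_add"
  shows "(\<Sum>n<2*m. f n) = (\<Sum>k<m. f (2*k)) + (\<Sum>k<m. f (2*k+1))"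
  by (induction m) (simp_all add: algebra_simps)

text \<open>Caratheodory's criterion. The shells \<open>R k\<close> of points of \<open>A\<close> whose distance to \<open>C\<close> lies
  between \<open>1/(k+2)\<close> and \<open>1/(k+1)\<close> have summable measure, because shells with indices of the same
  parity are positively separated.\<close>

lemma hausdorff_measure1_closed_split:
  fixes A C :: "'a::metric_space set"
  assumes C: "closed C"
  shows "hausdorff_measure1 (A \<inter> C) + hausdorff_measure1 (A - C) \<le> hausdorff_measure1 A"
proof (cases "C = {} \<or> hausdorff_measure1 A = top")
  case True
  then show ?thesis by auto
next
  case False
  then have ne: "C \<noteq> {}" and fin: "hausdorff_measure1 A < top" by (auto simp: top.not_eq_extremum)
  define D where "D n = {x\<in>A. 1 / (real n + 1) \<le> infdist x C}" for n
  define R where "R n = {x\<in>A. 1 / (real n + 2) \<le> infdist x C \<and> infdist x C < 1 / (real n + 1)}" for n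
  have lip: "infdist x C - infdist y C \<le> dist x y" for x y
    using infdist_triangle[of x C y] by simp
  have 1: "hausdorff_measure1 (A \<inter> C) + hausdorff_measure1 (D n) \<le> hausdorff_measure1 A" for n
  proof -
    have "hausdorff_measure1 (A \<inter> C) + hausdorff_measure1 (D n) \<le> hausdorff_measure1 ((A \<inter> C) \<union> D n)"
    proof (rule hausdorff_measure1_separated)
      show "1 / (real n + 1) \<le> dist x y" if "x \<in> A \<inter> C" "y \<in> D n" for x y
        using that infdist_le[of x C y] by (auto simp: D_def dist_commute)
    qed simp
    also have "\<dots> \<le> hausdorff_measure1 A" by (rule hausdorff_measure1_mono) (auto simp: D_def)
    finally show ?thesis .
  qed
  have parity: "(\<Sum>k<m. hausdorff_measure1 (R (2*k+p))) \<le> hausdorff_measure1 (\<Union>k<m. R (2*k+p))" for m p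
  proof (induction m)
    case (Suc m)
    \<comment> \<open>For \<open>k < m\<close> the points of shell \<open>2*k+p\<close> have
      distance at least \<open>1 / ?q\<close> from \<open>C\<close>, those of shell
      \<open>2*m+p\<close> less than \<open>1 / (?q + 1)\<close>. For \<open>m = 0\<close> the union
      is empty; this case is separate because \<open>?q\<close> may then be 0.\<close>
    let ?q = "real (2*m+p)"
    have "(\<Sum>k<Suc m. hausdorff_measure1 (R (2*k+p)))
        \<le> hausdorff_measure1 (\<Union>k<m. R (2*k+p)) + hausdorff_measure1 (R (2*m+p))"
      using Suc by (simp add: add_right_mono)
    also have "\<dots> \<le> hausdorff_measure1 ((\<Union>k<m. R (2*k+p)) \<union> R (2*m+p))"
    proof (cases "m = 0")
      case False
      show ?thesis
      proof (rule hausdorff_measure1_separated)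
        show "0 < 1 / ?q - 1 / (?q + 1)" using False by (simp add: divide_strict_left_mono)
        fix x y assume "x \<in> (\<Union>k<m. R (2*k+p))" and y: "y \<in> R (2*m+p)"
        then obtain k where k: "k < m" "x \<in> R (2*k+p)" by auto
        have "1 / ?q \<le> 1 / (real (2*k+p) + 2)"
          using k(1) by (intro divide_left_mono) auto
        also have "\<dots> \<le> infdist x C" using k by (simp add: R_def)
        finally show "1 / ?q - 1 / (?q + 1) \<le> dist x y"
          using y lip[of x y] by (simp add: R_def)
      qed
    qed simp
    also have "(\<Union>k<m. R (2*k+p)) \<union> R (2*m+p) = (\<Union>k<Suc m. R (2*k+p))"
      by (auto simp: less_Suc_eq)
    finally show ?case .
  qed simp
  have parityA: "(\<Sum>k<m. hausdorff_measure1 (R (2*k+p))) \<le> hausdorff_measure1 A" for m p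
    by (rule order_trans[OF parity hausdorff_measure1_mono]) (auto simp: R_def)
  have "(\<Sum>n. hausdorff_measure1 (R n)) \<le> 2 * hausdorff_measure1 A"
    unfolding suminf_eq_SUP
  proof (rule SUP_least)
    fix m
    have "(\<Sum>n<m. hausdorff_measure1 (R n)) \<le> (\<Sum>n<2*m. hausdorff_measure1 (R n))"
      by (intro sum_mono2) auto
    also have "\<dots> \<le> hausdorff_measure1 A + hausdorff_measure1 A"
      unfolding sum_even_odd using add_mono[OF parityA[of 0 m] parityA[of 1 m]] by simp
    finally show "(\<Sum>n<m. hausdorff_measure1 (R n)) \<le> 2 * hausdorff_measure1 A"
      by (simp add: mult_2)
  qed
  also have "\<dots> < top" using fin by (simp add: ennreal_mult_less_top)
  finally have sumR: "(\<Sum>n. hausdorff_measure1 (R n)) < top" .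
  define g where "g n = enn2real (hausdorff_measure1 (R n))" for n
  have g: "hausdorff_measure1 (R n) = ennreal (g n)" for n
    using ennreal_suminf_lessD[OF sumR] by (simp add: g_def)
  have gs: "summable g"
    using sumR by (intro summable_suminf_not_top) (auto simp: g[symmetric], simp add: g_def)
  show ?thesis
  proof (rule ennreal_le_epsilon)
    fix e :: real assume e: "0 < e"
    \<comment> \<open>Points of \<open>A - C\<close> outside \<open>D N\<close> lie in shells of
      index at least \<open>N\<close>, whose total measure is bounded by the tail of a convergent
      series.\<close>
    obtain N where N: "\<And>n. n \<ge> N \<Longrightarrow> norm (\<Sum>i. g (i + n)) < e"
      using suminf_exist_split[OF e gs] by blast
    have "A - C \<subseteq> D N \<union> (\<Union>i. R (i + N))"
    proof
      fix x assume x: "x \<in> A - C"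
      then have pos: "0 < infdist x C"
        using in_closed_iff_infdist_zero[OF C ne, of x] infdist_nonneg[of x C] by auto
      show "x \<in> D N \<union> (\<Union>i. R (i + N))"
      proof (cases "1 / (real N + 1) \<le> infdist x C")
        case True
        then show ?thesis using x by (auto simp: D_def)
      next
        case False
        \<comment> \<open>The least \<open>k\<close> with \<open>P k\<close> selects the shell of
          \<open>x\<close>: its lower bound is \<open>P k\<close>, its upper bound the failure of
          the predecessor, or \<open>False\<close> if \<open>k = 0\<close>. Some \<open>k\<close>
          exists because \<open>x\<close> has positive distance from the closed set
          \<open>C\<close>.\<close>
        define P where "P k \<longleftrightarrow> 1 / (real (k + N) + 2) \<le> infdist x C" for k
        obtain n where n: "inverse (real (Suc n)) < infdist x C" using reals_Archimedean[OF pos] by auto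
        have "P n"
        proof -
          have "1 / (real (n + N) + 2) \<le> inverse (real (Suc n))" by (simp add: field_simps)
          then show ?thesis using n by (simp add: P_def)
        qed
        then have L: "P (LEAST k. P k)" by (rule LeastI)
        have "infdist x C < 1 / (real ((LEAST k. P k) + N) + 1)"
        proof (cases "LEAST k. P k")
          case (Suc j)
          then have "\<not> P j" using not_less_Least[of j P] by simp
          then have "infdist x C < 1 / (real (Suc j + N) + 1)" by (simp add: P_def algebra_simps)
          then show ?thesis by (simp only: Suc)
        qed (use False in \<open>simp add: algebra_simps\<close>)
        then have "x \<in> R ((LEAST k. P k) + N)" using L x by (simp add: R_def P_def)
        then show ?thesis by blast
      qed
    qed
    then have "hausdorff_measure1 (A - C) \<le> hausdorff_measure1 (D N) + hausdorff_measure1 (\<Union>i. R (i + N))"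
      by (rule order_trans[OF hausdorff_measure1_mono hausdorff_measure1_Un])
    also have "\<dots> \<le> hausdorff_measure1 (D N) + (\<Sum>i. hausdorff_measure1 (R (i + N)))"
      by (intro add_left_mono hausdorff_measure1_UN)
    also have "(\<Sum>i. hausdorff_measure1 (R (i + N))) = ennreal (\<Sum>i. g (i + N))"
      unfolding g by (intro suminf_ennreal2 summable_ignore_initial_segment gs) (simp add: g_def)
    also have "\<dots> \<le> ennreal e" using N[of N] by (intro ennreal_leI) simp
    finally have "hausdorff_measure1 (A - C) \<le> hausdorff_measure1 (D N) + ennreal e"
      by (simp add: add_left_mono)
    then have "hausdorff_measure1 (A \<inter> C) + hausdorff_measure1 (A - C)
        \<le> (hausdorff_measure1 (A \<inter> C) + hausdorff_measure1 (D N)) + ennreal e"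
      by (simp add: add_left_mono add.assoc)
    also have "\<dots> \<le> hausdorff_measure1 A + ennreal e" by (intro add_right_mono 1)
    finally show "hausdorff_measure1 (A \<inter> C) + hausdorff_measure1 (A - C)
        \<le> hausdorff_measure1 A + ennreal e" .
  qed
qed

text \<open>Cutting \<open>X \<union> Y\<close> and \<open>Y\<close> along the closed set
  \<open>X\<close> leaves the same remainder \<open>Y - X\<close>. The symmetric form avoids
  subtraction in \<open>ennreal\<close>.\<close>

lemma hausdorff_measure1_modular:
  fixes X Y :: "'a::metric_space set"
  assumes X: "closed X"
  shows "hausdorff_measure1 (X \<union> Y) + hausdorff_measure1 (X \<inter> Y)
    = hausdorff_measure1 X + hausdorff_measure1 Y"
proof -
  have eq: "hausdorff_measure1 Z = hausdorff_measure1 (Z \<inter> X) + hausdorff_measure1 (Z - X)" for Z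
    using hausdorff_measure1_closed_split[OF X, of Z] hausdorff_measure1_Un[of "Z \<inter> X" "Z - X"]
    by (simp add: Int_Diff_Un antisym)
  have "hausdorff_measure1 (X \<union> Y) = hausdorff_measure1 X + hausdorff_measure1 (Y - X)"
    using eq[of "X \<union> Y"] by (simp add: Un_Diff Int_absorb1)
  moreover have "hausdorff_measure1 Y = hausdorff_measure1 (X \<inter> Y) + hausdorff_measure1 (Y - X)"
    using eq[of Y] by (simp add: Int_commute)
  ultimately show ?thesis by (simp add: ac_simps)
qed

section \<open>Lengths of intervals and segments\<close>

text \<open>From above, \<open>n\<close> intervals of length \<open>1 / n\<close>; from below,
  comparison with Lebesgue measure, where scale 1 is enough because the supremum over all scales
  dominates it.\<close>

lemma hausdorff_measure1_unit_interval: "hausdorff_measure1 {0..1::real} = 1"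
proof (rule antisym)
  show "hausdorff_measure1 {0..1::real} \<le> 1"
    unfolding hausdorff_measure1_def
  proof (rule SUP_least)
    fix \<delta> :: real assume "\<delta> \<in> {0<..}"
    then obtain n' where n': "inverse (real (Suc n')) < \<delta>" using reals_Archimedean by auto
    define n where "n = Suc n'"
    have n: "n > 0" "1 / real n \<le> \<delta>" using n' by (simp_all add: n_def field_simps)
    define U where "U i = (if i < n then {real i / n..(real i + 1) / n} else {})" for i
    have diam: "diameter (U i) = (if i < n then 1 / n else 0)" for i
      using n by (auto simp: U_def field_simps)
    have "hausdorff_premeasure1 \<delta> {0..1::real} \<le> (\<Sum>i. ennreal (diameter (U i)))"
    proof (rule hausdorff_premeasure1_le)
      show "{0..1} \<subseteq> (\<Union>i. U i)"
      proof
        fix x :: real assume x: "x \<in> {0..1}"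
        show "x \<in> (\<Union>i. U i)"
        \<comment> \<open>At the right end the index given by the floor would be \<open>n\<close>,
          which is out of range.\<close>
        proof (cases "x = 1")
          case True
          then have "x \<in> U (n - 1)" using n by (simp add: U_def of_nat_diff)
          then show ?thesis by blast
        next
          case False
          define i where "i = nat \<lfloor>x * n\<rfloor>"
          have i: "real i \<le> x * n" "x * n < real i + 1"
            using x by (auto simp: i_def of_nat_floor)
          have "x * n < 1 * real n" using x False n by (intro mult_strict_right_mono) auto
          then have "i < n" using i(1) by linarith
          then have "x \<in> U i" using i n by (simp add: U_def field_simps)
          then show ?thesis by blast
        qed
      qed
      show "diameter (U i) \<le> \<delta>" for i
        using n \<open>\<delta> \<in> {0<..}\<close> by (simp add: diam)
    qed (simp add: U_def)
    also have "\<dots> = (\<Sum>i<n. ennreal (1 / n))"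
      by (subst suminf_finite[of "{..<n}"]) (auto simp: diam)
    also have "\<dots> = 1" using n by (simp add: ennreal_of_nat_eq_real_of_nat ennreal_mult'[symmetric])
    finally show "hausdorff_premeasure1 \<delta> {0..1::real} \<le> 1" .
  qed
next
  have "1 \<le> hausdorff_premeasure1 1 {0..1::real}"
    unfolding hausdorff_premeasure1_def
  proof (rule INF_greatest)
    fix U :: "nat \<Rightarrow> real set"
    assume "U \<in> {U. {0..1} \<subseteq> (\<Union>i. U i) \<and> (\<forall>i. bounded (U i) \<and> diameter (U i) \<le> 1)}"
    then have U: "{0..1} \<subseteq> (\<Union>i. U i)" "\<And>i. bounded (U i)" by auto
    \<comment> \<open>The covering sets may be non-measurable; their closed hulls are intervals no
      longer than the diameters.\<close>
    define V where "V i = (if U i = {} then {} else {Inf (U i)..Sup (U i)})" for i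
    have UV: "U i \<subseteq> V i" for i
      using U(2)[of i] by (auto simp: V_def cInf_lower cSup_upper bounded_imp_bdd_above bounded_imp_bdd_below)
    have em: "emeasure lborel (V i) \<le> ennreal (diameter (U i))" for i
    proof (cases "U i = {}")
      case False
      have "x \<le> y + diameter (U i)" if "x \<in> U i" "y \<in> U i" for x y
        using diameter_bounded_bound[OF U(2) that] by (simp add: dist_real_def)
      then have "Sup (U i) - diameter (U i) \<le> y" if "y \<in> U i" for y
        using cSup_least[OF False, of "y + diameter (U i)"] that by fastforce
      then have "Sup (U i) - diameter (U i) \<le> Inf (U i)" by (intro cInf_greatest False)
      moreover have "Inf (U i) \<le> Sup (U i)"
        using False U(2)[of i] by (intro cInf_le_cSup bounded_imp_bdd_above bounded_imp_bdd_below)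
      ultimately show ?thesis using False by (simp add: V_def ennreal_leI)
    qed (simp add: V_def)
    have "1 = emeasure lborel {0..1::real}" by simp
    also have "\<dots> \<le> emeasure lborel (\<Union>i. V i)"
      using U(1) UV by (intro emeasure_mono) (force, auto simp: V_def)
    also have "\<dots> \<le> (\<Sum>i. emeasure lborel (V i))"
      by (rule emeasure_subadditive_countably) (auto simp: V_def)
    also have "\<dots> \<le> (\<Sum>i. ennreal (diameter (U i)))" by (intro suminf_le em summableI)
    finally show "1 \<le> (\<Sum>i. ennreal (diameter (U i)))" .
  qed
  also have "\<dots> \<le> hausdorff_measure1 {0..1::real}" by (rule hausdorff_premeasure1_le_measure) simp
  finally show "1 \<le> hausdorff_measure1 {0..1::real}" .
qed

text \<open>The affine parametrization multiplies all distances by \<open>dist a b\<close>, so it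
  and its inverse are Lipschitz with reciprocal constants.\<close>

lemma hausdorff_measure1_segment:
  fixes a b :: "'a::real_normed_vector"
  shows "hausdorff_measure1 (closed_segment a b) = ennreal (dist a b)"
proof (cases "a = b")
  case False
  let ?f = "\<lambda>u. (1 - u) *\<^sub>R a + u *\<^sub>R b"
  have f: "dist (?f u) (?f v) = dist a b * dist u v" for u v
  proof -
    have "?f u - ?f v = (v - u) *\<^sub>R (a - b)" by (simp add: algebra_simps)
    then show ?thesis by (simp add: dist_norm mult.commute abs_minus_commute)
  qed
  have inj: "inj ?f" using f False by (intro injI) (metis dist_eq_0_iff mult_eq_0_iff)
  have d: "0 < dist a b" using False by simp
  have img: "closed_segment a b = ?f ` {0..1}" by (rule closed_segment_image_interval)
  have "hausdorff_measure1 (inv ?f ` ?f ` {0..1}) \<le> ennreal (1 / dist a b) * hausdorff_measure1 (?f ` {0..1})"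
    using d by (intro hausdorff_measure1_lipschitz_image) (auto simp: f inv_f_f[OF inj])
  then have "ennreal (dist a b) * 1 \<le> ennreal (dist a b) * (ennreal (1 / dist a b) * hausdorff_measure1 (?f ` {0..1}))"
    using inj by (intro mult_left_mono) (auto simp: image_inv_f_f hausdorff_measure1_unit_interval)
  also have "\<dots> = hausdorff_measure1 (?f ` {0..1})"
    using d by (simp add: mult.assoc[symmetric] ennreal_mult'[symmetric])
  finally have "ennreal (dist a b) \<le> hausdorff_measure1 (?f ` {0..1})" by simp
  moreover have "hausdorff_measure1 (?f ` {0..1}) \<le> ennreal (dist a b) * hausdorff_measure1 {0..1::real}"
    by (rule hausdorff_measure1_lipschitz_image[OF d]) (simp add: f)
  ultimately show ?thesis
    unfolding img by (simp add: hausdorff_measure1_unit_interval)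
qed simp

section \<open>Perimeters of planar convex bodies\<close>

text \<open>A set without interior lies in a hyperplane, whose normal is constant on it; otherwise
  relative interior and interior agree and the usual supporting hyperplane applies. Thin sets and
  strict sublevel sets, which need not be closed, are among the uses.\<close>

lemma supporting_functional:
  fixes K :: "'a::euclidean_space set"
  assumes "convex K" "q \<in> K" "q \<notin> interior K"
  obtains a where "a \<noteq> 0" "\<And>y. y \<in> K \<Longrightarrow> a \<bullet> y \<le> a \<bullet> q"
proof (cases "interior K = {}")
  case True
  from empty_interior_subset_hyperplane[OF assms(1) True]
  obtain a b where "a \<noteq> 0" "K \<subseteq> {x. a \<bullet> x = b}" by blast
  then have "a \<bullet> y = b" if "y \<in> K" for y using that by auto
  with \<open>a \<noteq> 0\<close> show ?thesis using that[of a] assms(2) by simp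
next
  case False
  then have "rel_interior K = interior K" by (rule rel_interior_nonempty_interior)
  with supporting_hyperplane_rel_boundary[OF assms(1,2)] assms(3)
  obtain a where "a \<noteq> 0" "\<And>y. y \<in> K \<Longrightarrow> a \<bullet> q \<le> a \<bullet> y" by metis
  then show ?thesis using that[of "- a"] by auto
qed

text \<open>In the expansion of the squared norm of \<open>s a + (q - z)\<close> the mixed term is
  nonnegative, because \<open>a\<close> is an outer normal at \<open>q\<close>.\<close>

lemma closest_point_ray:
  fixes K :: "'a::euclidean_space set"
  assumes K: "convex K" "closed K" "q \<in> K" and a: "\<And>y. y \<in> K \<Longrightarrow> a \<bullet> y \<le> a \<bullet> q" and s: "0 \<le> s"
  shows "closest_point K (q + s *\<^sub>R a) = q"
proof -
  have "dist (q + s *\<^sub>R a) q \<le> dist (q + s *\<^sub>R a) z" if z: "z \<in> K" for z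
  proof -
    have "0 \<le> s * (a \<bullet> (q - z))" using a[OF z] s by (simp add: inner_diff_right)
    moreover have "(s *\<^sub>R a + (q - z)) \<bullet> (s *\<^sub>R a + (q - z))
        = (s *\<^sub>R a) \<bullet> (s *\<^sub>R a) + 2 * (s * (a \<bullet> (q - z))) + (q - z) \<bullet> (q - z)"
      by (simp add: inner_add_left inner_add_right inner_commute)
    ultimately have "(s *\<^sub>R a) \<bullet> (s *\<^sub>R a) \<le> (s *\<^sub>R a + (q - z)) \<bullet> (s *\<^sub>R a + (q - z))"
      using inner_ge_zero[of "q - z"] by linarith
    then have "norm (s *\<^sub>R a) \<le> norm (s *\<^sub>R a + (q - z))" unfolding norm_le .
    then show ?thesis by (simp add: dist_norm algebra_simps)
  qed
  then show ?thesis using closest_point_unique[OF K, of "q + s *\<^sub>R a"] by simp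
qed

lemma ray_meets_frontier:
  fixes L :: "'a::euclidean_space set"
  assumes "bounded L" "q \<in> L" "a \<noteq> 0"
  obtains s where "0 \<le> s" "q + s *\<^sub>R a \<in> frontier L"
proof -
  obtain B where B: "\<And>x. x \<in> L \<Longrightarrow> norm x \<le> B" using assms(1) bounded_iff by blast
  \<comment> \<open>Far enough out that \<open>q + T a\<close> has norm at least
    \<open>B + 1\<close> and so lies outside \<open>L\<close>.\<close>
  define T where "T = (B + norm q + 1) / norm a"
  have B0: "0 \<le> B" using B[OF assms(2)] norm_ge_zero[of q] by linarith
  have T0: "0 \<le> T" using B0 by (simp add: T_def)
  have "norm (T *\<^sub>R a) = B + norm q + 1" using assms(3) T0 B0 by (simp add: T_def)
  then have "B < norm (q + T *\<^sub>R a)" using norm_triangle_ineq4[of "q + T *\<^sub>R a" q] by simp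
  then have far: "q + T *\<^sub>R a \<notin> L" using B by fastforce
  have "closed_segment q (q + T *\<^sub>R a) \<inter> frontier L \<noteq> {}"
    using assms(2) far by (intro connected_Int_frontier connected_segment) auto
  then obtain u where u: "0 \<le> u" "(1 - u) *\<^sub>R q + u *\<^sub>R (q + T *\<^sub>R a) \<in> frontier L"
    by (auto simp: in_segment)
  have "(1 - u) *\<^sub>R q + u *\<^sub>R (q + T *\<^sub>R a) = q + (u * T) *\<^sub>R a" by (simp add: algebra_simps)
  then show ?thesis using that[of "u * T"] u T0 by simp
qed

text \<open>The nearest-point map onto \<open>K\<close> is 1-Lipschitz and maps \<open>frontier L\<close> onto \<open>frontier K\<close>.\<close>

lemma hausdorff_measure1_frontier_mono:
  fixes K L :: "'a::euclidean_space set"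
  assumes K: "compact K" "convex K" and L: "bounded L" and KL: "K \<subseteq> L"
  shows "hausdorff_measure1 (frontier K) \<le> hausdorff_measure1 (frontier L)"
proof (cases "K = {}")
  case False
  have "frontier K \<subseteq> closest_point K ` frontier L"
  proof
    fix q assume "q \<in> frontier K"
    then have q: "q \<in> K" "q \<notin> interior K"
      using compact_imp_closed[OF K(1)] by (auto simp: frontier_def)
    obtain a where a: "a \<noteq> 0" "\<And>y. y \<in> K \<Longrightarrow> a \<bullet> y \<le> a \<bullet> q"
      using supporting_functional[OF K(2) q] by blast
    obtain s where s: "0 \<le> s" "q + s *\<^sub>R a \<in> frontier L"
      using ray_meets_frontier[OF L _ a(1)] q KL by blast
    have "closest_point K (q + s *\<^sub>R a) = q"
      using closest_point_ray[OF K(2) compact_imp_closed[OF K(1)] q(1) a(2) s(1)] by blast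
    then show "q \<in> closest_point K ` frontier L" using s(2) by force
  qed
  then have "hausdorff_measure1 (frontier K) \<le> hausdorff_measure1 (closest_point K ` frontier L)"
    by (rule hausdorff_measure1_mono)
  also have "\<dots> \<le> ennreal 1 * hausdorff_measure1 (frontier L)"
    using closest_point_lipschitz[OF K(2) compact_imp_closed[OF K(1)] False]
    by (intro hausdorff_measure1_lipschitz_image) auto
  finally show ?thesis by simp
qed simp

text \<open>Comparison with an enclosing square, whose frontier is covered by four segments.\<close>

lemma hausdorff_measure1_frontier_finite:
  fixes K :: "(real \<times> real) set"
  assumes "compact K" "convex K"
  shows "hausdorff_measure1 (frontier K) < top"
proof -
  obtain c where c: "\<And>x. x \<in> K \<Longrightarrow> norm x \<le> c"
    using compact_imp_bounded[OF assms(1)] bounded_iff by blast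
  define L where "L = {p :: real \<times> real. \<bar>fst p\<bar> \<le> c \<and> \<bar>snd p\<bar> \<le> c}"
  have L_eq: "L = {-c..c} \<times> {-c..c}" by (auto simp: L_def)
  have bL: "bounded L" unfolding L_eq by (simp add: bounded_Times)
  have KL: "K \<subseteq> L"
  proof
    fix p assume "p \<in> K"
    then show "p \<in> L" using c[of p] norm_fst_le[of "fst p" "snd p"] norm_snd_le[of "snd p" "fst p"]
      by (auto simp: L_def)
  qed
  let ?S = "\<lambda>a b. closed_segment a b :: (real \<times> real) set"
  have vert: "(d, y) \<in> ?S (d, -c) (d, c)" and horz: "(y, d) \<in> ?S (-c, d) (c, d)"
    if "\<bar>y\<bar> \<le> c" for d y
    using that by (auto simp: closed_segment_PairD closed_segment_eq_real_ivl segment_degen_1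
        closed_segment_same_fst closed_segment_same_snd)
  have "frontier L \<subseteq> (?S (c, -c) (c, c) \<union> ?S (-c, -c) (-c, c)) \<union> (?S (-c, c) (c, c) \<union> ?S (-c, -c) (c, -c))"
  proof
    fix p assume p: "p \<in> frontier L"
    have "closed L" unfolding L_eq by (intro closed_Times closed_atLeastAtMost)
    then have pL: "p \<in> L" "p \<notin> interior L" using p by (auto simp: frontier_def)
    have "{-c<..<c} \<times> {-c<..<c} \<subseteq> interior L"
      by (rule interior_maximal) (auto simp: L_def intro!: open_Times)
    then have "p \<notin> {-c<..<c} \<times> {-c<..<c}" using pL by blast
    then have "\<bar>fst p\<bar> = c \<or> \<bar>snd p\<bar> = c" using pL(1) by (cases p) (auto simp: L_def)
    then show "p \<in> (?S (c, -c) (c, c) \<union> ?S (-c, -c) (-c, c)) \<union> (?S (-c, c) (c, c) \<union> ?S (-c, -c) (c, -c))"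
      using pL(1) vert[of "snd p" "fst p"] horz[of "fst p" "snd p"]
      by (cases p) (auto simp: L_def abs_if split: if_splits)
  qed
  then have "hausdorff_measure1 (frontier L)
    \<le> hausdorff_measure1 ((?S (c, -c) (c, c) \<union> ?S (-c, -c) (-c, c)) \<union> (?S (-c, c) (c, c) \<union> ?S (-c, -c) (c, -c)))"
    by (rule hausdorff_measure1_mono)
  also have "\<dots> \<le> (ennreal (dist (c, -c) (c, c)) + ennreal (dist (-c, -c) (-c, c)))
      + (ennreal (dist (-c, c) (c, c)) + ennreal (dist (-c, -c) (c, -c)))"
    unfolding hausdorff_measure1_segment[symmetric]
    by (intro order_trans[OF hausdorff_measure1_Un] add_mono hausdorff_measure1_Un)
  also have "\<dots> < top" by simp
  finally show ?thesis
    using hausdorff_measure1_frontier_mono[OF assms bL KL] by (rule le_less_trans[rotated])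
qed

section \<open>Thin bodies and the doubled length\<close>

lemma aff_dim_plane_interior:
  fixes K :: "(real \<times> real) set"
  assumes "convex K"
  shows "aff_dim K = 2 \<longleftrightarrow> interior K \<noteq> {}"
  using interior_rel_interior_gen[of K] rel_interior_eq_empty[OF assms] by auto

lemma planar_thin_segment:
  fixes K :: "(real \<times> real) set"
  assumes "compact K" "convex K" "interior K = {}" "K \<noteq> {}"
  obtains a b where "K = closed_segment a b"
proof -
  have "aff_dim K \<le> 1"
    using aff_dim_plane_interior[OF assms(2)] assms(3) aff_dim_le_DIM[of K] by simp
  then show ?thesis
    using compact_convex_collinear_segment[OF assms(4,1,2)] that collinear_aff_dim by blast
qed

text \<open>The orthogonal complement of \<open>v\<close> is a line. In coordinates, both entries of
  \<open>v\<close> annihilate the determinant of \<open>a\<close> and \<open>e\<close>, which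
  therefore vanishes; \<open>k\<close> is the projection coefficient of \<open>e\<close> onto
  \<open>a\<close>.\<close>

lemma orthogonal_plane_parallel:
  fixes a e v :: "real \<times> real"
  assumes "a \<bullet> v = 0" "e \<bullet> v = 0" "v \<noteq> 0" "a \<noteq> 0"
  obtains k where "e = k *\<^sub>R a"
proof -
  obtain v1 v2 a1 a2 e1 e2 where v: "v = (v1, v2)" "a = (a1, a2)" "e = (e1, e2)"
    by (cases v, cases a, cases e) auto
  define k where "k = (a1 * e1 + a2 * e2) / (a1\<^sup>2 + a2\<^sup>2)"
  have n: "a1\<^sup>2 + a2\<^sup>2 \<noteq> 0" using assms(4) by (auto simp: v zero_prod_def sum_power2_eq_zero_iff)
  have eqs: "a1 * v1 + a2 * v2 = 0" "e1 * v1 + e2 * v2 = 0" "v1 \<noteq> 0 \<or> v2 \<noteq> 0"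
    using assms by (auto simp: v zero_prod_def)
  have "v1 * (a1 * e2 - a2 * e1) = 0" "v2 * (a1 * e2 - a2 * e1) = 0" using eqs(1,2) by algebra+
  then have cr: "a1 * e2 = a2 * e1" using eqs(3) by auto
  have "e1 * (a1\<^sup>2 + a2\<^sup>2) = (a1 * e1 + a2 * e2) * a1" "e2 * (a1\<^sup>2 + a2\<^sup>2) = (a1 * e1 + a2 * e2) * a2"
    using cr by algebra+
  then have "e = k *\<^sub>R a" using n by (simp add: v k_def field_simps)
  then show ?thesis by (rule that)
qed

text \<open>Cut \<open>L\<close> along the line through the segment. The boundary of one part contains the segment
  and also a curve off the line which the nearest-point map sends onto the open segment.\<close>

lemma hausdorff_measure1_segment_le_frontier:
  fixes L :: "(real \<times> real) set"
  assumes L: "compact L" "convex L" "interior L \<noteq> {}" and ab: "closed_segment a b \<subseteq> L"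
  shows "2 * hausdorff_measure1 (closed_segment a b) \<le> hausdorff_measure1 (frontier L)"
proof (cases "a = b")
  case False
  define d where "d = b - a"
  obtain d1 d2 where d12: "d = (d1, d2)" by (cases d) auto
  have d0: "d \<noteq> 0" using False by (simp add: d_def)
  define m :: "real \<times> real" where "m = (- d2, d1)"
  have md: "m \<bullet> d = 0" by (simp add: m_def d12)
  have m0: "m \<noteq> 0" using d0 by (auto simp: m_def d12 zero_prod_def)
  have "\<exists>z\<in>L. m \<bullet> (z - a) \<noteq> 0"
  proof (rule ccontr)
    assume "\<not> ?thesis"
    then have "L \<subseteq> {x. m \<bullet> x = m \<bullet> a}" by (auto simp: inner_diff_right)
    then have "interior L \<subseteq> interior {x. m \<bullet> x = m \<bullet> a}" by (rule interior_mono)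
    then show False using L(3) m0 by simp
  qed
  then obtain z where z: "z \<in> L" "m \<bullet> (z - a) \<noteq> 0" by blast
  \<comment> \<open>The sign turns the normal towards \<open>z\<close>, so the half-plane kept in
    \<open>L'\<close> contains \<open>z\<close>.\<close>
  define n where "n = sgn (m \<bullet> (z - a)) *\<^sub>R m"
  have n: "n \<bullet> d = 0" "n \<noteq> 0" "0 < n \<bullet> (z - a)"
    using z(2) md m0 by (auto simp: n_def sgn_if)
  have n_line: "n \<bullet> (a + s *\<^sub>R d) = n \<bullet> a" for s using n(1) by (simp add: inner_add_right)
  define L' where "L' = L \<inter> {x. n \<bullet> a \<le> n \<bullet> x}"
  have L': "compact L'" "convex L'" "L' \<subseteq> L"
    using L by (auto simp: L'_def closed_halfspace_ge compact_Int_closed convex_Int convex_halfspace_ge)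
  have seg: "p \<in> closed_segment a b \<longleftrightarrow> (\<exists>s. 0 \<le> s \<and> s \<le> 1 \<and> p = a + s *\<^sub>R d)" for p
    by (auto simp: in_segment d_def algebra_simps)
  have oseg: "p \<in> open_segment a b \<longleftrightarrow> (\<exists>s. 0 < s \<and> s < 1 \<and> p = a + s *\<^sub>R d)" for p
    using False by (auto simp: in_segment d_def algebra_simps)
  have nseg: "n \<bullet> p = n \<bullet> a" if p: "p \<in> closed_segment a b" for p
  proof -
    obtain s where "p = a + s *\<^sub>R d" using p unfolding seg by blast
    then show ?thesis by (simp only: n_line)
  qed
  let ?C = "{x. n \<bullet> x = n \<bullet> a}"
  have "closed_segment a b \<subseteq> frontier L' \<inter> ?C"
  proof
    fix p assume p: "p \<in> closed_segment a b"
    then have "p \<in> L'" using ab nseg[OF p] by (auto simp: L'_def)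
    moreover have "p \<notin> interior L'"
    proof
      assume "p \<in> interior L'"
      also have "interior L' \<subseteq> interior {x. n \<bullet> a \<le> n \<bullet> x}" by (rule interior_mono) (auto simp: L'_def)
      finally show False using nseg[OF p] n(2) by simp
    qed
    ultimately show "p \<in> frontier L' \<inter> ?C"
      using nseg[OF p] compact_imp_closed[OF L'(1)] by (auto simp: frontier_def)
  qed
  then have part1: "hausdorff_measure1 (closed_segment a b) \<le> hausdorff_measure1 (frontier L' \<inter> ?C)"
    by (rule hausdorff_measure1_mono)
  have cover: "open_segment a b \<subseteq> closest_point (closed_segment a b) ` (frontier L' - ?C)"
  proof
    fix p assume p: "p \<in> open_segment a b"
    then obtain s where s: "0 < s" "s < 1" "p = a + s *\<^sub>R d" using oseg by auto
    have pc: "p \<in> closed_segment a b" using p open_closed_segment by blast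
    obtain \<alpha> \<beta> where coord: "z - a = \<alpha> *\<^sub>R d + \<beta> *\<^sub>R n"
    proof -
      define \<alpha> where "\<alpha> = ((z - a) \<bullet> d) / (d \<bullet> d)"
      have "(z - a - \<alpha> *\<^sub>R d) \<bullet> d = 0" using d0 by (simp add: \<alpha>_def inner_diff_left)
      then obtain k where "z - a - \<alpha> *\<^sub>R d = k *\<^sub>R n"
        using orthogonal_plane_parallel[OF n(1) _ d0 n(2)] by metis
      then show ?thesis by (intro that[of \<alpha> k]) (simp add: algebra_simps)
    qed
    have \<beta>: "0 < \<beta>"
    proof -
      have "n \<bullet> (z - a) = \<beta> * (n \<bullet> n)" unfolding coord using n(1) by (simp add: inner_add_right)
      then show ?thesis using n(2,3) by (simp add: zero_less_mult_iff) (metis inner_ge_zero not_less)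
    qed
    \<comment> \<open>The point \<open>p + (\<epsilon> * \<beta>) n\<close> is to be the convex
      combination, with weight \<open>\<epsilon>\<close> on \<open>z\<close>, of \<open>z\<close>
      and a point \<open>x\<close> of the segment. This forces the parameter
      \<open>(s - \<epsilon> * \<alpha>) / (1 - \<epsilon>)\<close> for \<open>x\<close>, and the
      bound by \<open>min s (1 - s)\<close> keeps it between 0 and 1.\<close>
    define \<epsilon> where "\<epsilon> = min s (1 - s) / (2 * (1 + \<bar>\<alpha>\<bar>))"
    have \<epsilon>: "0 < \<epsilon>" "\<epsilon> * (1 + \<bar>\<alpha>\<bar>) \<le> s / 2" "\<epsilon> * (1 + \<bar>\<alpha>\<bar>) \<le> (1 - s) / 2"
    proof -
      show "0 < \<epsilon>" unfolding \<epsilon>_def using s by (intro divide_pos_pos) auto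
      have "\<epsilon> * (1 + \<bar>\<alpha>\<bar>) = min s (1 - s) / 2" by (simp add: \<epsilon>_def field_simps)
      then show "\<epsilon> * (1 + \<bar>\<alpha>\<bar>) \<le> s / 2" "\<epsilon> * (1 + \<bar>\<alpha>\<bar>) \<le> (1 - s) / 2" by auto
    qed
    have ea: "\<epsilon> * \<alpha> \<le> \<epsilon> * \<bar>\<alpha>\<bar>" "- (\<epsilon> * \<alpha>) \<le> \<epsilon> * \<bar>\<alpha>\<bar>" "0 \<le> \<epsilon> * \<bar>\<alpha>\<bar>"
      using \<epsilon>(1) by (auto simp: abs_if)
    have eq: "\<epsilon> * (1 + \<bar>\<alpha>\<bar>) = \<epsilon> + \<epsilon> * \<bar>\<alpha>\<bar>" by (simp add: distrib_left)
    have e1: "\<epsilon> < 1" "0 \<le> s - \<epsilon> * \<alpha>" "s - \<epsilon> * \<alpha> \<le> 1 - \<epsilon>"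
      using \<epsilon> ea s(1,2) unfolding eq by argo+
    define x where "x = a + ((s - \<epsilon> * \<alpha>) / (1 - \<epsilon>)) *\<^sub>R d"
    have "x \<in> closed_segment a b" unfolding seg x_def using e1 by (intro exI[of _ "(s - \<epsilon> * \<alpha>) / (1 - \<epsilon>)"]) auto
    then have xL: "x \<in> L'" using ab nseg[of x] by (auto simp: L'_def)
    have zL: "z \<in> L'" using z(1) n(3) by (simp add: L'_def inner_diff_right)
    have zc: "z = a + (\<alpha> *\<^sub>R d + \<beta> *\<^sub>R n)" unfolding coord[symmetric] by simp
    have "(1 - \<epsilon>) *\<^sub>R x + \<epsilon> *\<^sub>R z = (1 - \<epsilon>) *\<^sub>R a + (s - \<epsilon> * \<alpha>) *\<^sub>R d + \<epsilon> *\<^sub>R (a + (\<alpha> *\<^sub>R d + \<beta> *\<^sub>R n))"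
      using e1(1) unfolding zc x_def by (simp add: scaleR_add_right)
    also have "\<dots> = p + (\<epsilon> * \<beta>) *\<^sub>R n" by (simp add: s(3) algebra_simps)
    finally have w: "p + (\<epsilon> * \<beta>) *\<^sub>R n \<in> L'"
      using convexD_alt[OF L'(2) xL zL, of \<epsilon>] \<epsilon>(1) e1(1) by simp
    \<comment> \<open>The ray starts strictly off the line and moves away from it, so its exit point
      avoids \<open>?C\<close>; since \<open>n\<close> is normal to the segment, that point projects
      back to \<open>p\<close>.\<close>
    obtain t where t: "0 \<le> t" "p + (\<epsilon> * \<beta>) *\<^sub>R n + t *\<^sub>R n \<in> frontier L'"
      using ray_meets_frontier[OF compact_imp_bounded[OF L'(1)] w n(2)] by blast
    define r where "r = \<epsilon> * \<beta> + t"
    have r: "0 < r" using \<epsilon>(1) \<beta> t(1) by (simp add: r_def add_pos_nonneg)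
    have pr: "p + r *\<^sub>R n \<in> frontier L'" using t(2) by (simp add: r_def algebra_simps)
    have "closest_point (closed_segment a b) (p + r *\<^sub>R n) = p"
      by (rule closest_point_ray) (simp_all add: pc nseg[OF pc] less_imp_le[OF r] eq_refl[OF nseg])
    moreover have "n \<bullet> (p + r *\<^sub>R n) \<noteq> n \<bullet> a"
      using nseg[OF pc] r n(2) by (simp add: inner_add_right)
    ultimately show "p \<in> closest_point (closed_segment a b) ` (frontier L' - ?C)"
      using pr by force
  qed
  \<comment> \<open>Only the open segment has been covered, but the two endpoints are null.\<close>
  have "hausdorff_measure1 (closed_segment a b) \<le> hausdorff_measure1 (open_segment a b \<union> {a, b})"
    by (rule hausdorff_measure1_mono) (auto simp: open_segment_def)
  also have "\<dots> \<le> hausdorff_measure1 (open_segment a b) + hausdorff_measure1 {a, b}"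
    by (rule hausdorff_measure1_Un)
  also have "\<dots> = hausdorff_measure1 (open_segment a b)" by (simp add: hausdorff_measure1_finite)
  also have "\<dots> \<le> hausdorff_measure1 (closest_point (closed_segment a b) ` (frontier L' - ?C))"
    by (rule hausdorff_measure1_mono[OF cover])
  also have "\<dots> \<le> ennreal 1 * hausdorff_measure1 (frontier L' - ?C)"
    using closest_point_lipschitz[of "closed_segment a b"]
    by (intro hausdorff_measure1_lipschitz_image) auto
  finally have part2: "hausdorff_measure1 (closed_segment a b) \<le> hausdorff_measure1 (frontier L' - ?C)"
    by simp
  have "2 * hausdorff_measure1 (closed_segment a b)
      \<le> hausdorff_measure1 (frontier L' \<inter> ?C) + hausdorff_measure1 (frontier L' - ?C)"
    using add_mono[OF part1 part2] by (simp only: mult_2)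
  also have "\<dots> \<le> hausdorff_measure1 (frontier L')"
    by (rule hausdorff_measure1_closed_split) (rule closed_hyperplane)
  also have "\<dots> \<le> hausdorff_measure1 (frontier L)"
    by (rule hausdorff_measure1_frontier_mono[OF L'(1,2) compact_imp_bounded[OF L(1)] L'(3)])
  finally show ?thesis .
qed simp

text \<open>A body without interior is its own frontier but is traversed twice.\<close>

definition perimeter1 :: "(real \<times> real) set \<Rightarrow> ennreal" where
  "perimeter1 K = (if interior K = {} then 2 * hausdorff_measure1 K else hausdorff_measure1 (frontier K))"

lemma perimeter1_empty [simp]: "perimeter1 {} = 0"
  by (simp add: perimeter1_def)

lemma perimeter1_finite:
  assumes "compact K" "convex K"
  shows "perimeter1 K < top"
proof (cases "interior K = {}")
  case True
  then have "frontier K = K" using compact_imp_closed[OF assms(1)] by (simp add: frontier_def)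
  then show ?thesis
    using True hausdorff_measure1_frontier_finite[OF assms] by (simp add: perimeter1_def ennreal_mult_less_top)
qed (use hausdorff_measure1_frontier_finite[OF assms] in \<open>simp add: perimeter1_def\<close>)

text \<open>Projection handles \<open>K\<close> with interior, inclusion handles two thin bodies. In
  the mixed case the segment estimate shows that the doubling in \<open>perimeter1\<close> is
  compatible with monotonicity.\<close>

lemma perimeter1_mono:
  assumes K: "compact K" "convex K" and L: "compact L" "convex L" and KL: "K \<subseteq> L"
  shows "perimeter1 K \<le> perimeter1 L"
proof (cases "interior K = {}")
  case True
  show ?thesis
  proof (cases "interior L = {}")
    case False
    show ?thesis
    proof (cases "K = {}")
      case K0: False
      obtain a b where "K = closed_segment a b" using planar_thin_segment[OF K True K0] .
      then show ?thesis
        using hausdorff_measure1_segment_le_frontier[OF L False] KL True False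
        by (simp add: perimeter1_def)
    qed simp
  qed (use True hausdorff_measure1_mono[OF KL] in \<open>simp add: perimeter1_def mult_left_mono\<close>)
next
  case False
  then have "interior L \<noteq> {}" using interior_mono[OF KL] by auto
  then show ?thesis
    using False hausdorff_measure1_frontier_mono[OF K compact_imp_bounded[OF L(1)] KL]
    by (simp add: perimeter1_def)
qed

lemma intrinsic_volume1_eq_perimeter1:
  assumes K: "compact K" "convex K"
  shows "intrinsic_volume1 K = enn2real (perimeter1 K) / 2"
proof (cases "interior K = {}")
  case True
  then have ne2: "aff_dim K \<noteq> 2" using aff_dim_plane_interior[OF K(2)] by simp
  show ?thesis
  proof (cases "aff_dim K = 1")
    case False
    have "aff_dim K \<le> 2" using aff_dim_le_DIM[of K] by simp
    moreover have "- 1 \<le> aff_dim K" by (rule aff_dim_geq)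
    ultimately have "aff_dim K = -1 \<or> aff_dim K = 0" using ne2 False by linarith
    then have "K = {} \<or> (\<exists>a. K = {a})" by (auto simp: aff_dim_eq_0 aff_dim_empty)
    then show ?thesis using ne2 False by (auto simp: intrinsic_volume1_def perimeter1_def)
  qed (use True ne2 in \<open>simp add: intrinsic_volume1_def perimeter1_def curve_length_def enn2real_mult\<close>)
next
  case False
  then show ?thesis
    using aff_dim_plane_interior[OF K(2)]
    by (simp add: intrinsic_volume1_def perimeter1_def perimeter_def curve_length_def)
qed

text \<open>If the interiors meet, the frontiers of union and intersection have the same union and
  the same intersection as the frontiers of \<open>K\<close> and \<open>L\<close>, and modularity
  applies. If they are nonempty and disjoint, \<open>K \<inter> L\<close> is contained in the
  separating line, equals the intersection of the two frontiers, and meets the frontier of the union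
  in finitely many points; its measure enters twice, as \<open>perimeter1\<close> demands of a thin
  set.\<close>

lemma perimeter1_valuation:
  assumes K: "compact K" "convex K" and L: "compact L" "convex L" and KL: "convex (K \<union> L)"
  shows "perimeter1 (K \<union> L) + perimeter1 (K \<inter> L) = perimeter1 K + perimeter1 L"
proof -
  have cl: "closed K" "closed L" using K L compact_imp_closed by auto
  have fr: "frontier K = K - interior K" "frontier L = L - interior L"
      "frontier (K \<union> L) = (K \<union> L) - interior (K \<union> L)"
      "frontier (K \<inter> L) = (K \<inter> L) - (interior K \<inter> interior L)"
    using cl by (auto simp: frontier_def closed_Un closed_Int interior_Int)
  have intU: "interior K \<subseteq> interior (K \<union> L)" "interior L \<subseteq> interior (K \<union> L)"
    by (auto intro!: interior_mono)
  \<comment> \<open>Off the closed set \<open>B\<close>, a small neighbourhood inside the union must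
    lie in \<open>A\<close>.\<close>
  have out: "interior (A \<union> B) - B \<subseteq> interior A" if "closed B" for A B :: "(real \<times> real) set"
    using that interior_subset[of "A \<union> B"] by (intro interior_maximal) (auto intro: open_Diff)
  have outK: "interior (K \<union> L) - L \<subseteq> interior K" by (rule out[OF cl(2)])
  have outL: "interior (K \<union> L) - K \<subseteq> interior L" using out[OF cl(1), of L] by (simp add: Un_commute)
  \<comment> \<open>Every point of the convex union is a limit of its interior points, so a point of
    \<open>A\<close> off \<open>B\<close> would force \<open>A\<close> to have interior.\<close>
  have thin: "A \<subseteq> B" if "convex (A \<union> B)" "closed B" "interior A = {}" "interior B \<noteq> {}"
    for A B :: "(real \<times> real) set"
  proof
    fix p assume p: "p \<in> A"
    show "p \<in> B"
    proof (rule ccontr)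
      assume pB: "p \<notin> B"
      have "interior (A \<union> B) \<noteq> {}" using that(4) interior_mono[of B "A \<union> B"] by auto
      then have "p \<in> closure (interior (A \<union> B))"
        using p closure_subset[of "A \<union> B"] by (auto simp: convex_closure_interior[OF that(1)])
      then have "interior (A \<union> B) \<inter> - B \<noteq> {}"
        using pB that(2) closure_iff_nhds_not_empty[of p "interior (A \<union> B)"] by blast
      then show False using out[OF that(2), of A] that(3) by blast
    qed
  qed
  consider (K) "interior K = {}" "interior L \<noteq> {}" | (L) "interior K \<noteq> {}" "interior L = {}"
    | (none) "interior K = {}" "interior L = {}"
    | (int) "interior K \<inter> interior L \<noteq> {}"
    | (sep) "interior K \<noteq> {}" "interior L \<noteq> {}" "interior K \<inter> interior L = {}"
    by blast
  then show ?thesis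
  proof cases
    case K
    then have "K \<subseteq> L" by (rule thin[OF KL cl(2)])
    then show ?thesis by (simp add: Un_absorb1 Int_absorb2 add.commute)
  next
    case L
    then have "L \<subseteq> K" using thin[of L K] KL cl by (simp add: Un_commute)
    then show ?thesis by (simp add: Un_absorb2 Int_absorb1)
  next
    case none
    moreover have "interior (K \<union> L) = {}"
      using interior_closed_Un_empty_interior[OF cl(1) none(2)] none by simp
    ultimately show ?thesis
      using arg_cong[OF hausdorff_measure1_modular[OF cl(1), of L], of "\<lambda>x. 2 * x"]
      by (simp add: perimeter1_def distrib_left)
  next
    case int
    then obtain z where z: "z \<in> interior K" "z \<in> interior L" by blast
    \<comment> \<open>Prolong the segment from \<open>z\<close> through \<open>x\<close> slightly to
      a point \<open>y\<close> still in the union. Then \<open>x\<close> lies strictly between a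
      common interior point and a point of one of the bodies, hence in the interior of that
      body.\<close>
    have key: "x \<notin> interior (K \<union> L)" if x: "x \<notin> interior K" "x \<notin> interior L" for x
    proof
      assume "x \<in> interior (K \<union> L)"
      then obtain e where e: "0 < e" "cball x e \<subseteq> K \<union> L" using mem_interior_cball by blast
      have xz: "x \<noteq> z" using x z by auto
      define y where "y = x + (e / norm (x - z)) *\<^sub>R (x - z)"
      have "y \<in> K \<union> L" using e xz by (intro subsetD[OF e(2)]) (simp add: y_def dist_norm)
      moreover have "x \<in> open_segment z y"
      proof -
        define c where "c = e / norm (x - z)"
        have c: "0 < c" using e xz by (simp add: c_def)
        have yz: "y - z = (1 + c) *\<^sub>R (x - z)" by (simp add: y_def c_def[symmetric] algebra_simps)
        then have "z \<noteq> y" using xz c by auto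
        moreover have "x = (1 - 1 / (1 + c)) *\<^sub>R z + (1 / (1 + c)) *\<^sub>R y"
        proof -
          have "(1 - 1 / (1 + c)) *\<^sub>R z + (1 / (1 + c)) *\<^sub>R y = z + (1 / (1 + c)) *\<^sub>R (y - z)"
            by (simp add: algebra_simps)
          also have "\<dots> = x" unfolding yz using c by simp
          finally show ?thesis by simp
        qed
        ultimately show ?thesis
          unfolding in_segment using c by (intro conjI exI[of _ "1 / (1 + c)"]) auto
      qed
      ultimately have "x \<in> interior K \<or> x \<in> interior L"
        using in_interior_closure_convex_segment[OF K(2) z(1), of y]
          in_interior_closure_convex_segment[OF L(2) z(2), of y] closure_subset by blast
      then show False using x by blast
    qed
    have un: "frontier (K \<union> L) \<union> frontier (K \<inter> L) = frontier K \<union> frontier L"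
      unfolding fr using intU outK outL interior_subset[of K] interior_subset[of L] by blast
    have int: "frontier (K \<union> L) \<inter> frontier (K \<inter> L) = frontier K \<inter> frontier L"
      unfolding fr using intU key by blast
    have "hausdorff_measure1 (frontier (K \<union> L)) + hausdorff_measure1 (frontier (K \<inter> L))
        = hausdorff_measure1 (frontier K) + hausdorff_measure1 (frontier L)"
      using hausdorff_measure1_modular[OF frontier_closed, of K "frontier L"]
        hausdorff_measure1_modular[OF frontier_closed, of "K \<union> L" "frontier (K \<inter> L)"]
      by (simp only: un int)
    moreover have "interior (K \<union> L) \<noteq> {}" "interior (K \<inter> L) \<noteq> {}"
      using intU z by (auto simp: interior_Int)
    ultimately show ?thesis using z by (auto simp: perimeter1_def)
  next
    case sep
    obtain a c where a: "a \<noteq> 0" "\<And>x. x \<in> interior K \<Longrightarrow> a \<bullet> x \<le> c" "\<And>x. x \<in> interior L \<Longrightarrow> c \<le> a \<bullet> x"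
      using separating_hyperplane_sets[OF convex_interior[OF K(2)] convex_interior[OF L(2)] sep] by blast
    have "K \<subseteq> closure (interior K)" "L \<subseteq> closure (interior L)"
      using convex_closure_interior[OF K(2) sep(1)] convex_closure_interior[OF L(2) sep(2)]
        closure_subset by auto
    moreover have "closure (interior K) \<subseteq> {x. a \<bullet> x \<le> c}" "closure (interior L) \<subseteq> {x. c \<le> a \<bullet> x}"
      by (rule closure_minimal; use a(2,3) closed_halfspace_le closed_halfspace_ge in blast)+
    ultimately have aK: "K \<subseteq> {x. a \<bullet> x \<le> c}" and aL: "L \<subseteq> {x. c \<le> a \<bullet> x}" by auto
    have intK: "interior K \<subseteq> {x. a \<bullet> x < c}" and intL: "interior L \<subseteq> {x. c < a \<bullet> x}"
      using interior_mono[OF aK] interior_mono[OF aL] a(1) by auto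
    let ?D = "K \<inter> L" and ?M = "frontier (K \<union> L)"
    have Dc: "a \<bullet> x = c" if "x \<in> ?D" for x using that aK aL by force
    have XY: "frontier K \<inter> frontier L = ?D"
      unfolding fr using Dc intK intL by force
    have MD: "?M \<union> ?D = frontier K \<union> frontier L"
    proof -
      have "?D \<subseteq> frontier K" using XY by blast
      then show ?thesis unfolding fr using intU outK outL by blast
    qed
    have "finite (?M \<inter> ?D)"
    proof (cases "?D = {}")
      case False
      have "interior ?D = {}" using sep by (simp add: interior_Int)
      then obtain p q where pq: "?D = closed_segment p q"
        using planar_thin_segment[OF compact_Int[OF K(1) L(1)] convex_Int[OF K(2) L(2)] _ False] by blast
      \<comment> \<open>A functional supporting the union at \<open>x\<close> would be constant
        along the segment, hence a multiple of \<open>a\<close>; but the union has points strictly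
        on both sides of the separating line.\<close>
      have "x \<in> interior (K \<union> L)" if x: "x \<in> open_segment p q" for x
      proof (rule ccontr)
        assume nx: "x \<notin> interior (K \<union> L)"
        have xD: "x \<in> ?D" using x open_closed_segment pq by blast
        then obtain e where e: "e \<noteq> 0" "\<And>y. y \<in> K \<union> L \<Longrightarrow> e \<bullet> y \<le> e \<bullet> x"
          using supporting_functional[OF KL _ nx] by blast
        obtain u where u: "p \<noteq> q" "0 < u" "u < 1" "x = (1 - u) *\<^sub>R p + u *\<^sub>R q"
          using x by (auto simp: in_segment)
        have pqD: "p \<in> ?D" "q \<in> ?D" unfolding pq by auto
        have "e \<bullet> p \<le> e \<bullet> x" "e \<bullet> q \<le> e \<bullet> x" using e(2) pqD by auto
        moreover have ex: "e \<bullet> x = e \<bullet> p + u * (e \<bullet> (q - p))"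
            "e \<bullet> x = e \<bullet> q - (1 - u) * (e \<bullet> (q - p))"
          unfolding u(4) by (simp_all add: inner_add_right inner_diff_right algebra_simps)
        ultimately have "0 \<le> u * (e \<bullet> (q - p))" "(1 - u) * (e \<bullet> (q - p)) \<le> 0" by linarith+
        then have eqp: "e \<bullet> (q - p) = 0" using u(2,3)
          by (simp add: zero_le_mult_iff mult_le_0_iff)
        have aqp: "a \<bullet> (q - p) = 0" using Dc pqD by (simp add: inner_diff_right)
        obtain k where k: "e = k *\<^sub>R a"
          using orthogonal_plane_parallel[OF aqp eqp _ a(1)] u(1) by auto
        have ka: "k * (a \<bullet> y) \<le> k * c" if "y \<in> K \<union> L" for y
          using e(2)[OF that] Dc[OF xD] by (simp add: k)
        obtain y z where yz: "y \<in> interior K" "z \<in> interior L" using sep by blast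
        then have "a \<bullet> y < c" "c < a \<bullet> z" using intK intL by auto
        moreover have "k * (a \<bullet> y) \<le> k * c" "k * (a \<bullet> z) \<le> k * c"
          using ka yz interior_subset by blast+
        ultimately have "k = 0" by (simp add: mult_le_cancel_left)
        then show False using e(1) k by simp
      qed
      then have "?M \<inter> ?D \<subseteq> {p, q}" unfolding pq fr open_segment_def by blast
      then show ?thesis using finite_subset by blast
    qed simp
    then have "hausdorff_measure1 (?M \<inter> ?D) = 0" by (rule hausdorff_measure1_finite)
    then have "hausdorff_measure1 (frontier K \<union> frontier L) = hausdorff_measure1 ?M + hausdorff_measure1 ?D"
      using hausdorff_measure1_modular[OF frontier_closed, of "K \<union> L" ?D] by (simp add: MD)
    then have "hausdorff_measure1 ?M + 2 * hausdorff_measure1 ?D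
        = hausdorff_measure1 (frontier K) + hausdorff_measure1 (frontier L)"
      using hausdorff_measure1_modular[OF frontier_closed, of K "frontier L"]
      by (simp add: XY mult_2 add.assoc)
    moreover have "interior (K \<union> L) \<noteq> {}" "interior ?D = {}"
      using sep intU by (auto simp: interior_Int)
    ultimately show ?thesis using sep by (simp add: perimeter1_def)
  qed
qed

section \<open>Behaviour under similarities\<close>

lemma similarity_inverse:
  fixes f :: "'a::metric_space \<Rightarrow> 'b::metric_space"
  assumes r: "0 < r" and f: "\<And>x y. dist (f x) (f y) = r * dist x y" and surj: "surj f"
  obtains g where "\<And>x. g (f x) = x" "\<And>y. f (g y) = y" "continuous_on UNIV f" "continuous_on UNIV g"
    "\<And>x y. dist (g x) (g y) = (1 / r) * dist x y"
proof
  have inj: "inj f" using f r by (intro injI) (metis dist_eq_0_iff mult_eq_0_iff less_irrefl)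
  show gf: "inv f (f x) = x" and fg: "f (inv f y) = y" for x y
    using inj surj by (simp_all add: surj_f_inv_f)
  show g: "dist (inv f x) (inv f y) = (1 / r) * dist x y" for x y
    using f[of "inv f x" "inv f y"] r by (simp add: fg)
  show "continuous_on UNIV f" "continuous_on UNIV (inv f)"
    by (rule lipschitz_on_continuous_on[of r] lipschitz_on_continuous_on[of "1/r"],
        rule lipschitz_onI; use f g r in simp)+
qed

lemma closure_similarity_image:
  fixes f :: "'a::metric_space \<Rightarrow> 'b::metric_space"
  assumes r: "0 < r" and f: "\<And>x y. dist (f x) (f y) = r * dist x y" and surj: "surj f"
  shows "closure (f ` A) = f ` closure A"
proof
  obtain g where g: "\<And>x. g (f x) = x" "\<And>y. f (g y) = y" "continuous_on UNIV f" "continuous_on UNIV g"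
    using similarity_inverse[OF r f surj] by metis
  have "f ` closure A = g -` closure A" using g(1,2) by (auto simp: image_iff) (metis g(2))
  then have "closed (f ` closure A)" using closed_vimage[OF closed_closure g(4)] by simp
  then show "closure (f ` A) \<subseteq> f ` closure A"
    by (intro closure_minimal image_mono closure_subset)
  show "f ` closure A \<subseteq> closure (f ` A)"
    by (intro image_closure_subset continuous_on_subset[OF g(3)] closure_subset) auto
qed

text \<open>Used with \<open>r = 1\<close> for rigid motions and with \<open>r = 1 - e\<close> for
  the shrunken bodies in the continuity argument. Interiors and frontiers are carried along by the
  homeomorphism, and the Lipschitz bounds for \<open>f\<close> and its inverse make the scaling
  exact.\<close>

lemma perimeter1_similarity:
  assumes K: "closed K" and r: "0 < r" and f: "\<And>x y. dist (f x) (f y) = r * dist x y" and surj: "surj f"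
  shows "perimeter1 (f ` K) = ennreal r * perimeter1 K"
proof -
  obtain g where gf: "\<And>x. g (f x) = x" and fg: "\<And>y. f (g y) = y"
    and cf: "continuous_on UNIV f" and cg: "continuous_on UNIV g"
    and g: "\<And>x y. dist (g x) (g y) = (1 / r) * dist x y"
    using similarity_inverse[OF r f surj] by metis
  have inj: "inj f" using gf by (rule inj_on_inverseI)
  have im: "f ` A = g -` A" for A using fg gf by (auto simp: image_iff) (metis fg)
  have vi: "g ` A = f -` A" for A using fg gf by (auto simp: image_iff) (metis gf)
  have "interior (f ` K) = f ` interior K"
  proof
    have "f ` interior K \<subseteq> f ` K" using interior_subset by blast
    then show "f ` interior K \<subseteq> interior (f ` K)"
      using open_vimage[OF open_interior cg] by (intro interior_maximal) (auto simp: im)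
    have "g ` interior (f ` K) \<subseteq> K" using interior_subset[of "f ` K"] by (auto simp: gf)
    then have "g ` interior (f ` K) \<subseteq> interior K"
      using open_vimage[OF open_interior cf] by (intro interior_maximal) (auto simp: vi)
    then have "f ` g ` interior (f ` K) \<subseteq> f ` interior K" by (rule image_mono)
    then show "interior (f ` K) \<subseteq> f ` interior K" by (simp add: image_image fg)
  qed
  moreover have "closed (f ` K)" unfolding im by (rule closed_vimage[OF K cg])
  ultimately have fr: "frontier (f ` K) = f ` frontier K"
    using K inj by (simp add: frontier_def image_set_diff)
  have H: "hausdorff_measure1 (f ` A) = ennreal r * hausdorff_measure1 A" for A
  proof (rule antisym)
    show "hausdorff_measure1 (f ` A) \<le> ennreal r * hausdorff_measure1 A"
      by (rule hausdorff_measure1_lipschitz_image[OF r]) (simp add: f)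
    have "hausdorff_measure1 (g ` f ` A) \<le> ennreal (1 / r) * hausdorff_measure1 (f ` A)"
      using r g by (intro hausdorff_measure1_lipschitz_image) auto
    then have "ennreal r * hausdorff_measure1 A \<le> ennreal r * (ennreal (1 / r) * hausdorff_measure1 (f ` A))"
      by (intro mult_left_mono) (auto simp: image_image gf)
    also have "\<dots> = hausdorff_measure1 (f ` A)"
      using r by (simp add: mult.assoc[symmetric] ennreal_mult'[symmetric])
    finally show "ennreal r * hausdorff_measure1 A \<le> hausdorff_measure1 (f ` A)" .
  qed
  show ?thesis
    using \<open>interior (f ` K) = f ` interior K\<close> by (simp add: perimeter1_def fr H mult.left_commute)
qed

section \<open>Sublevel sets\<close>

definition sublevel :: "real \<Rightarrow> (real \<Rightarrow> ereal) \<Rightarrow> (real \<times> real) set" where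
  "sublevel t u = {p. hat u p < ereal t}"

text \<open>For \<open>u\<close> in \<open>coercive_convex\<close> this is the closure of
  \<open>sublevel t u\<close> unless the latter is empty: at the minimal level of \<open>u\<close>
  only the closed version is nonempty.\<close>

definition closed_sublevel :: "real \<Rightarrow> (real \<Rightarrow> ereal) \<Rightarrow> (real \<times> real) set" where
  "closed_sublevel t u = {p. hat u p \<le> ereal t}"

text \<open>With \<open>\<bar>y\<bar>\<close> on the real side, no sum in \<open>ereal\<close>
  remains.\<close>

lemma mem_sublevel: "(x, y) \<in> sublevel t u \<longleftrightarrow> u x < ereal (t - \<bar>y\<bar>)"
  by (cases "u x") (auto simp: sublevel_def hat_def)

lemma mem_closed_sublevel: "(x, y) \<in> closed_sublevel t u \<longleftrightarrow> u x \<le> ereal (t - \<bar>y\<bar>)"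
  by (cases "u x") (auto simp: closed_sublevel_def hat_def)

lemma sublevel_subset_closed: "sublevel t u \<subseteq> closed_sublevel t u"
  by (auto simp: sublevel_def closed_sublevel_def)

section \<open>Convexity, closedness and boundedness of sublevel sets\<close>

lemma convex_fun_real_bound:
  assumes "convex_fun u" "\<And>x. u x \<noteq> -\<infinity>"
    and "u x \<le> ereal s" "u y \<le> ereal r" "0 \<le> a" "0 \<le> b" "a + b = 1"
  shows "u (a *\<^sub>R x + b *\<^sub>R y) \<le> ereal (a * s + b * r)"
proof -
  obtain \<alpha> where \<alpha>: "u x = ereal \<alpha>" "\<alpha> \<le> s" using assms(2)[of x] assms(3) by (cases "u x") auto
  obtain \<beta> where \<beta>: "u y = ereal \<beta>" "\<beta> \<le> r" using assms(2)[of y] assms(4) by (cases "u y") auto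
  have "u (a *\<^sub>R x + b *\<^sub>R y) \<le> ereal a * u x + ereal b * u y"
    using assms(1,5-7) by (auto simp: convex_fun_def)
  also have "\<dots> \<le> ereal (a * s + b * r)"
    using \<alpha> \<beta> assms(5,6) by (simp add: add_mono mult_left_mono)
  finally show ?thesis .
qed

text \<open>Levels are averaged together with points. Equal levels give convexity; different ones
  give the strict inequalities used for segments ending in a strict point.\<close>

lemma hat_convex_bound:
  assumes u: "convex_fun u" "\<And>x. u x \<noteq> -\<infinity>"
    and pq: "p \<in> closed_sublevel s u" "q \<in> closed_sublevel r u" and ab: "0 \<le> a" "0 \<le> b" "a + b = 1"
  shows "a *\<^sub>R p + b *\<^sub>R q \<in> closed_sublevel (a * s + b * r) u"
proof -
  obtain x y x' y' where c: "p = (x, y)" "q = (x', y')" by (cases p, cases q)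
  have "u (a *\<^sub>R x + b *\<^sub>R x') \<le> ereal (a * (s - \<bar>y\<bar>) + b * (r - \<bar>y'\<bar>))"
    using pq ab by (intro convex_fun_real_bound[OF u]) (auto simp: c mem_closed_sublevel)
  also have "a * (s - \<bar>y\<bar>) + b * (r - \<bar>y'\<bar>) \<le> (a * s + b * r) - \<bar>a * y + b * y'\<bar>"
    using abs_triangle_ineq[of "a * y" "b * y'"] ab by (simp add: abs_mult algebra_simps)
  finally show ?thesis by (simp add: c mem_closed_sublevel)
qed

lemma sublevel_shrink:
  assumes "p \<in> sublevel t u"
  obtains s where "s < t" "p \<in> closed_sublevel s u"
proof -
  obtain s where "hat u p < ereal s" "ereal s < ereal t"
    using assms ereal_dense2 unfolding sublevel_def by blast
  then show ?thesis by (intro that[of s]) (auto simp: closed_sublevel_def)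
qed

lemma closed_sublevel_mono: "s < t \<Longrightarrow> closed_sublevel s u \<subseteq> sublevel t u"
  by (auto simp: sublevel_def closed_sublevel_def intro: le_less_trans)

text \<open>The point \<open>q\<close> already lies at a level \<open>s < t\<close>, and its
  positive weight pulls the averaged level below \<open>t\<close>.\<close>

lemma sublevel_convex_comb:
  assumes u: "convex_fun u" "\<And>x. u x \<noteq> -\<infinity>"
    and pq: "p \<in> closed_sublevel t u" "q \<in> sublevel t u" and ab: "0 \<le> a" "0 < b" "a + b = 1"
  shows "a *\<^sub>R p + b *\<^sub>R q \<in> sublevel t u"
proof -
  obtain s where s: "s < t" "q \<in> closed_sublevel s u" using sublevel_shrink[OF pq(2)] .
  have "a *\<^sub>R p + b *\<^sub>R q \<in> closed_sublevel (a * t + b * s) u"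
    using ab by (intro hat_convex_bound[OF u pq(1) s(2)]) auto
  moreover have "a * t + b * s < t"
  proof -
    have "a * t + b * s < a * t + b * t" using s(1) ab by simp
    also have "\<dots> = t" using ab by (simp flip: distrib_right)
    finally show ?thesis .
  qed
  ultimately show ?thesis using closed_sublevel_mono by blast
qed

lemma convex_sublevel:
  assumes u: "convex_fun u" "\<And>x. u x \<noteq> -\<infinity>"
  shows "convex (sublevel t u)"
proof (rule convexI)
  fix p q :: "real \<times> real" and a b :: real
  assume *: "p \<in> sublevel t u" "q \<in> sublevel t u" "0 \<le> a" "0 \<le> b" "a + b = 1"
  show "a *\<^sub>R p + b *\<^sub>R q \<in> sublevel t u"
  proof (cases "b = 0")
    case False
    then show ?thesis using sublevel_convex_comb[OF u, of p t q a b] * sublevel_subset_closed by auto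
  qed (use * in simp)
qed

lemma convex_closed_sublevel:
  assumes u: "convex_fun u" "\<And>x. u x \<noteq> -\<infinity>"
  shows "convex (closed_sublevel t u)"
proof (rule convexI)
  fix p q :: "real \<times> real" and a b :: real
  assume *: "p \<in> closed_sublevel t u" "q \<in> closed_sublevel t u" "0 \<le> a" "0 \<le> b" "a + b = 1"
  have "a * t + b * t = t" using *(5) by (simp flip: distrib_right)
  then show "a *\<^sub>R p + b *\<^sub>R q \<in> closed_sublevel t u"
    using hat_convex_bound[OF u *] by simp
qed

lemma coercive_convexD:
  assumes "u \<in> coercive_convex"
  shows "convex_fun u" "\<And>x. u x \<noteq> -\<infinity>" "lower_semicontinuous u" "(u \<longlongrightarrow> \<infinity>) at_infinity"
  using assms by (auto simp: coercive_convex_def)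

lemma open_superlevel:
  fixes u :: "'a::topological_space \<Rightarrow> ereal"
  assumes "lower_semicontinuous u"
  shows "open {x. c < u x}"
  unfolding open_subopen[of "{x. c < u x}"]
proof clarify
  fix x assume x: "c < u x"
  also have "\<dots> \<le> Liminf (at x) u" using assms by (simp add: lower_semicontinuous_def)
  finally have "eventually (\<lambda>y. c < u y) (at x)" by (rule less_LiminfD)
  \<comment> \<open>\<open>Liminf (at x)\<close> ignores the point \<open>x\<close> itself, where
    the inequality is the assumption.\<close>
  then obtain T where "open T" "x \<in> T" "\<And>y. y \<in> T \<Longrightarrow> y \<noteq> x \<Longrightarrow> c < u y"
    by (auto simp: eventually_at_topological)
  then show "\<exists>T. open T \<and> x \<in> T \<and> T \<subseteq> {x. c < u x}" using x by (intro exI[of _ T]) auto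
qed

text \<open>A real \<open>c\<close> strictly between \<open>t - \<bar>y\<bar>\<close> and
  \<open>u x\<close> decouples the two variables, so the complement is a union of products of open
  sets.\<close>

lemma closed_closed_sublevel:
  assumes "lower_semicontinuous u"
  shows "closed (closed_sublevel t u)"
proof -
  have "- closed_sublevel t u = (\<Union>c. {x. ereal c < u x} \<times> {y. t - \<bar>y\<bar> < c})"
  proof (intro equalityI subsetI)
    fix p assume "p \<in> - closed_sublevel t u"
    moreover obtain x y where p: "p = (x, y)" by (cases p)
    ultimately have "ereal (t - \<bar>y\<bar>) < u x" by (simp add: mem_closed_sublevel)
    then obtain c where "ereal (t - \<bar>y\<bar>) < ereal c" "ereal c < u x" using ereal_dense2 by blast
    then have "p \<in> {x. ereal c < u x} \<times> {y. t - \<bar>y\<bar> < c}" by (simp add: p)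
    then show "p \<in> (\<Union>c. {x. ereal c < u x} \<times> {y. t - \<bar>y\<bar> < c})" by blast
  next
    fix p assume "p \<in> (\<Union>c. {x. ereal c < u x} \<times> {y. t - \<bar>y\<bar> < c})"
    then obtain x y c where p: "p = (x, y)" "ereal c < u x" "t - \<bar>y\<bar> < c" by auto
    then have "ereal (t - \<bar>y\<bar>) < u x" using less_trans[of "ereal (t - \<bar>y\<bar>)" "ereal c"] by simp
    then show "p \<in> - closed_sublevel t u" by (simp add: p(1) mem_closed_sublevel)
  qed
  moreover have "open {y. t - \<bar>y\<bar> < c}" for c by (intro open_Collect_less continuous_intros)
  ultimately show ?thesis
    unfolding closed_def by (auto intro!: open_Times open_superlevel[OF assms])
qed

lemma bounded_closed_sublevel:
  assumes u: "u \<in> coercive_convex"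
  shows "bounded (closed_sublevel t u)"
proof -
  note D = coercive_convexD[OF u]
  have "eventually (\<lambda>x. ereal t < u x) at_infinity"
    using D(4) by (simp add: tendsto_PInfty)
  then obtain B where B: "\<And>x. B \<le> norm x \<Longrightarrow> ereal t < u x" by (auto simp: eventually_at_infinity)
  \<comment> \<open>Coercivity confines only \<open>x\<close>. Confining \<open>y\<close> takes a
    lower bound of \<open>u\<close> on \<open>{-B..B}\<close>, found by covering this compact
    interval with open superlevel sets.\<close>
  have "\<exists>n::nat. \<forall>x\<in>{-B..B}. ereal (- real n) < u x"
  proof -
    have "{-B..B} \<subseteq> (\<Union>n. {x. ereal (- real n) < u x})"
    proof
      fix x
      have "\<exists>n. ereal (- real n) < u x"
      proof (cases "u x")
        case (real r)
        obtain n where "- r < real n" using reals_Archimedean2 by blast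
        then show ?thesis using real by (intro exI[of _ n]) auto
      qed (use D(2)[of x] in auto)
      then show "x \<in> (\<Union>n. {x. ereal (- real n) < u x})" by blast
    qed
    then obtain C where C: "finite C" "{-B..B} \<subseteq> (\<Union>n\<in>C. {x. ereal (- real n) < u x})"
      using compactE_image[OF compact_Icc[of "-B" B], of UNIV "\<lambda>n. {x. ereal (- real n) < u x}"]
        open_superlevel[OF D(3)] by auto
    show ?thesis
    \<comment> \<open>\<open>insert 0\<close> keeps the maximum meaningful if \<open>C\<close> is
      empty.\<close>
    proof (intro exI[of _ "Max (insert 0 C)"] ballI)
      fix x assume "x \<in> {-B..B}"
      then obtain n where n: "n \<in> C" "ereal (- real n) < u x" using C by auto
      have "ereal (- real (Max (insert 0 C))) \<le> ereal (- real n)" using n(1) C(1) by simp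
      then show "ereal (- real (Max (insert 0 C))) < u x" using n(2) by (rule le_less_trans)
    qed
  qed
  then obtain n :: nat where n: "\<And>x. x \<in> {-B..B} \<Longrightarrow> ereal (- real n) < u x" by blast
  have "closed_sublevel t u \<subseteq> {-B..B} \<times> {- (t + n)..t + n}"
  proof clarify
    fix x y assume "(x, y) \<in> closed_sublevel t u"
    then have le: "u x \<le> ereal (t - \<bar>y\<bar>)" by (simp add: mem_closed_sublevel)
    also have "\<dots> \<le> ereal t" by simp
    finally have "x \<in> {-B..B}" using B[of x] by (cases "B \<le> norm x") (auto simp: not_le)
    moreover have "ereal (- real n) < ereal (t - \<bar>y\<bar>)"
      using less_le_trans[OF n le] \<open>x \<in> {-B..B}\<close> by blast
    ultimately show "x \<in> {-B..B} \<and> y \<in> {- (t + n)..t + n}" by auto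
  qed
  then show ?thesis by (rule bounded_subset[rotated]) (simp add: bounded_Times)
qed

text \<open>The open segment from any point of the closed sublevel set to a strict point stays
  strict, so its endpoints lie in the closure.\<close>

lemma closure_sublevel:
  assumes u: "u \<in> coercive_convex" and ne: "sublevel t u \<noteq> {}"
  shows "closure (sublevel t u) = closed_sublevel t u"
proof
  note D = coercive_convexD[OF u]
  show "closure (sublevel t u) \<subseteq> closed_sublevel t u"
    by (intro closure_minimal sublevel_subset_closed closed_closed_sublevel D)
  obtain z where z: "z \<in> sublevel t u" using ne by blast
  show "closed_sublevel t u \<subseteq> closure (sublevel t u)"
  proof
    fix p assume p: "p \<in> closed_sublevel t u"
    show "p \<in> closure (sublevel t u)"
    proof (cases "p = z")
      case False
      have "open_segment p z \<subseteq> sublevel t u"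
      proof
        fix x assume "x \<in> open_segment p z"
        then obtain b where "0 < b" "b < 1" "x = (1 - b) *\<^sub>R p + b *\<^sub>R z" by (auto simp: in_segment)
        then show "x \<in> sublevel t u" using sublevel_convex_comb[OF D(1,2) p z, of "1 - b" b] by simp
      qed
      then have "closure (open_segment p z) \<subseteq> closure (sublevel t u)" by (rule closure_mono)
      then show ?thesis using False by auto
    qed (use z closure_subset in blast)
  qed
qed

lemma
  assumes u: "u \<in> coercive_convex"
  shows compact_closure_sublevel: "compact (closure (sublevel t u))"
    and convex_closure_sublevel: "convex (closure (sublevel t u))"
proof -
  have "bounded (sublevel t u)"
    by (rule bounded_subset[OF bounded_closed_sublevel[OF u] sublevel_subset_closed])
  then show "compact (closure (sublevel t u))" by simp
  show "convex (closure (sublevel t u))"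
    using convex_sublevel coercive_convexD[OF u] by (intro convex_closure) blast
qed

lemma level_V1_eq_perimeter1:
  assumes "u \<in> coercive_convex"
  shows "level_V1 t u = enn2real (perimeter1 (closure (sublevel t u))) / 2"
  using intrinsic_volume1_eq_perimeter1[OF compact_closure_sublevel[OF assms] convex_closure_sublevel[OF assms]]
  by (simp add: level_V1_def sublevel_def)

lemma perimeter1_sublevel_finite:
  "u \<in> coercive_convex \<Longrightarrow> perimeter1 (closure (sublevel t u)) < top"
  by (intro perimeter1_finite compact_closure_sublevel convex_closure_sublevel)

section \<open>The functional on convex functions\<close>

lemma sublevel_antimono: "(\<And>x. v x \<le> u x) \<Longrightarrow> sublevel t u \<subseteq> sublevel t v"
proof clarify
  fix x y assume "\<And>x. v x \<le> u x" "(x, y) \<in> sublevel t u"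
  then show "(x, y) \<in> sublevel t v" unfolding mem_sublevel by (blast intro: le_less_trans)
qed

lemma decreasing_level_V1: "decreasing_functional (level_V1 t)"
  unfolding decreasing_functional_def
proof (intro ballI impI)
  fix u v :: "real \<Rightarrow> ereal"
  assume uv: "u \<in> coercive_convex" "v \<in> coercive_convex" "\<forall>x. u x \<ge> v x"
  then have "perimeter1 (closure (sublevel t u)) \<le> perimeter1 (closure (sublevel t v))"
    by (intro perimeter1_mono compact_closure_sublevel convex_closure_sublevel closure_mono sublevel_antimono) auto
  then show "level_V1 t u \<le> level_V1 t v"
    using uv perimeter1_sublevel_finite[OF uv(2)]
    by (simp add: level_V1_eq_perimeter1 enn2real_mono)
qed

section \<open>The valuation property\<close>

lemma sublevel_min: "sublevel t (\<lambda>x. min (u x) (v x)) = sublevel t u \<union> sublevel t v"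
  by (auto simp: mem_sublevel min_less_iff_disj)

lemma sublevel_max: "sublevel t (\<lambda>x. max (u x) (v x)) = sublevel t u \<inter> sublevel t v"
  by (auto simp: mem_sublevel)

text \<open>At a level \<open>s < t\<close> the two sublevel sets are closed and cover a segment joining them.\<close>

lemma sublevels_meet:
  assumes u: "u \<in> coercive_convex" and v: "v \<in> coercive_convex"
    and uv: "(\<lambda>x. min (u x) (v x)) \<in> coercive_convex"
    and p: "p \<in> sublevel t u" and q: "q \<in> sublevel t v"
  shows "sublevel t u \<inter> sublevel t v \<noteq> {}"
proof -
  obtain s1 where s1: "s1 < t" "p \<in> closed_sublevel s1 u" using sublevel_shrink[OF p] .
  obtain s2 where s2: "s2 < t" "q \<in> closed_sublevel s2 v" using sublevel_shrink[OF q] .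
  define s where "s = max s1 s2"
  have st: "s < t" using s1 s2 by (simp add: s_def)
  have mono: "closed_sublevel a w \<subseteq> closed_sublevel b w" if "a \<le> b" for a b w
    using that by (auto simp: closed_sublevel_def intro: order_trans)
  have ps: "p \<in> closed_sublevel s u" and qs: "q \<in> closed_sublevel s v"
    using s1 s2 mono[of s1 s u] mono[of s2 s v] by (auto simp: s_def)
  have cover: "closed_sublevel s (\<lambda>x. min (u x) (v x)) = closed_sublevel s u \<union> closed_sublevel s v"
    by (auto simp: mem_closed_sublevel min_le_iff_disj)
  have "convex (closed_sublevel s (\<lambda>x. min (u x) (v x)))"
    using coercive_convexD[OF uv] by (intro convex_closed_sublevel)
  then have seg: "closed_segment p q \<subseteq> closed_sublevel s u \<union> closed_sublevel s v"
    unfolding cover using ps qs by (intro closed_segment_subset) auto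
  have "closed_sublevel s u \<inter> closed_sublevel s v \<inter> closed_segment p q \<noteq> {}"
    using connected_segment(1)[of p q] seg ps qs
      closed_closed_sublevel[OF coercive_convexD(3)[OF u], of s]
      closed_closed_sublevel[OF coercive_convexD(3)[OF v], of s]
    unfolding connected_closed by (metis Int_iff empty_iff ends_in_segment)
  then show ?thesis using closed_sublevel_mono[OF st] by blast
qed

lemma valuation_level_V1: "valuation (level_V1 t)"
  unfolding valuation_def
proof (intro conjI ballI impI)
  show "level_V1 t (\<lambda>_. \<infinity>) = 0"
    by (simp add: level_V1_def hat_def intrinsic_volume1_def aff_dim_empty split_def)
next
  fix u v :: "real \<Rightarrow> ereal"
  assume u: "u \<in> coercive_convex" and v: "v \<in> coercive_convex"
    and uv: "(\<lambda>x. min (u x) (v x)) \<in> coercive_convex"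
  define K where "K = closure (sublevel t u)"
  define L where "L = closure (sublevel t v)"
  have K: "compact K" "convex K" and L: "compact L" "convex L"
    unfolding K_def L_def using u v compact_closure_sublevel convex_closure_sublevel by blast+
  have un: "closure (sublevel t (\<lambda>x. min (u x) (v x))) = K \<union> L"
    by (simp add: K_def L_def sublevel_min)
  \<comment> \<open>Closure does not commute with intersection in general. Here the open segments
    from points of \<open>K \<inter> L\<close> to a common strict point \<open>z\<close> lie in both
    strict sublevel sets.\<close>
  have int: "closure (sublevel t (\<lambda>x. max (u x) (v x))) = K \<inter> L"
  proof (cases "sublevel t u = {} \<or> sublevel t v = {}")
    case False
    then obtain z where z: "z \<in> sublevel t u" "z \<in> sublevel t v"
      using sublevels_meet[OF u v uv] by blast
    have KL: "K = closed_sublevel t u" "L = closed_sublevel t v"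
      unfolding K_def L_def using closure_sublevel u v False by auto
    show ?thesis
    proof
      show "closure (sublevel t (\<lambda>x. max (u x) (v x))) \<subseteq> K \<inter> L"
        unfolding sublevel_max K_def L_def using closure_mono[OF Int_lower1] closure_mono[OF Int_lower2] by blast
      show "K \<inter> L \<subseteq> closure (sublevel t (\<lambda>x. max (u x) (v x)))"
      proof
        fix p assume p: "p \<in> K \<inter> L"
        show "p \<in> closure (sublevel t (\<lambda>x. max (u x) (v x)))"
        proof (cases "p = z")
          case False
          have "open_segment p z \<subseteq> sublevel t u \<inter> sublevel t v"
          proof
            fix x assume "x \<in> open_segment p z"
            then obtain b where "0 < b" "b < 1" "x = (1 - b) *\<^sub>R p + b *\<^sub>R z" by (auto simp: in_segment)
            then show "x \<in> sublevel t u \<inter> sublevel t v"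
              using sublevel_convex_comb[OF coercive_convexD(1,2)[OF u], of p t z "1 - b" b]
                sublevel_convex_comb[OF coercive_convexD(1,2)[OF v], of p t z "1 - b" b] p z KL by simp
          qed
          then have "closure (open_segment p z) \<subseteq> closure (sublevel t u \<inter> sublevel t v)"
            by (rule closure_mono)
          then show ?thesis using False by (auto simp: sublevel_max)
        qed (use z closure_subset in \<open>force simp: sublevel_max\<close>)
      qed
    qed
  qed (auto simp: K_def L_def sublevel_max)
  have cKL: "convex (K \<union> L)" using convex_closure_sublevel[OF uv, of t] un by simp
  have val: "perimeter1 (K \<union> L) + perimeter1 (K \<inter> L) = perimeter1 K + perimeter1 L"
    by (rule perimeter1_valuation[OF K L cKL])
  have fin: "perimeter1 K < top" "perimeter1 L < top" "perimeter1 (K \<union> L) < top" "perimeter1 (K \<inter> L) < top"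
    using K L cKL by (auto intro!: perimeter1_finite compact_Un compact_Int convex_Int)
  have iv: "intrinsic_volume1 (K \<union> L) + intrinsic_volume1 (K \<inter> L)
      = intrinsic_volume1 K + intrinsic_volume1 L"
    using arg_cong[OF val, of enn2real] fin K L cKL
    by (simp add: intrinsic_volume1_eq_perimeter1 compact_Un compact_Int convex_Int enn2real_plus
        flip: add_divide_distrib)
  have lv: "level_V1 t w = intrinsic_volume1 (closure (sublevel t w))" for w
    by (simp add: level_V1_def sublevel_def)
  show "level_V1 t (\<lambda>x. max (u x) (v x)) + level_V1 t (\<lambda>x. min (u x) (v x)) = level_V1 t u + level_V1 t v"
    using iv unfolding lv un int K_def[symmetric] L_def[symmetric] by (simp add: add.commute)
qed

lemma rigid_motion_invariant_level_V1: "rigid_motion_invariant (level_V1 t)"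
  unfolding rigid_motion_invariant_def
proof (intro ballI allI impI)
  fix u :: "real \<Rightarrow> ereal" and T :: "real \<Rightarrow> real"
  assume u: "u \<in> coercive_convex" and "rigid_motion T"
  then obtain R x0 where R: "orthogonal_transformation R" and T: "\<And>x. T x = R x + x0"
    by (auto simp: rigid_motion_def)
  define f where "f = (\<lambda>(x, y :: real). (T x, y))"
  have f: "dist (f p) (f q) = 1 * dist p q" for p q
    using R[unfolded orthogonal_transformation_isometry]
    by (cases p; cases q) (simp add: f_def T dist_Pair_Pair)
  have surj: "surj f"
  proof (rule surjI)
    show "f (inv R (fst p - x0), snd p) = p" for p
      using surj_f_inv_f[OF orthogonal_transformation_surj[OF R]] by (cases p) (simp add: f_def T)
  qed
  have S: "f ` sublevel t (u \<circ> T) = sublevel t u"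
  proof -
    have "sublevel t (u \<circ> T) = f -` sublevel t u" by (auto simp: f_def mem_sublevel)
    then show ?thesis using surj by simp
  qed
  have cl: "closure (sublevel t u) = f ` closure (sublevel t (u \<circ> T))"
    using closure_similarity_image[OF zero_less_one f surj, of "sublevel t (u \<circ> T)"] by (simp add: S)
  obtain g where g: "\<And>x. g (f x) = x" "continuous_on UNIV g"
    using similarity_inverse[OF zero_less_one f surj] by metis
  have gcl: "closure (sublevel t (u \<circ> T)) = g ` closure (sublevel t u)"
    unfolding cl by (simp add: image_image g)
  \<comment> \<open>Membership of \<open>u \<circ> T\<close> in \<open>coercive_convex\<close> is
    bypassed: compactness is transported along the inverse isometry, and convexity holds because
    \<open>T\<close> is affine.\<close>
  have "compact (closure (sublevel t (u \<circ> T)))"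
    unfolding gcl by (intro compact_continuous_image compact_closure_sublevel u continuous_on_subset[OF g(2)]) auto
  moreover have "convex (closure (sublevel t (u \<circ> T)))"
  proof (intro convex_closure convex_sublevel)
    have "T (a *\<^sub>R x + b *\<^sub>R y) = a *\<^sub>R T x + b *\<^sub>R T y" if "a + b = 1" for a b x y
    proof -
      have "x0 = a * x0 + b * x0" using that by (simp flip: distrib_right)
      moreover have "R (a *\<^sub>R x + b *\<^sub>R y) = a *\<^sub>R R x + b *\<^sub>R R y"
        using orthogonal_transformation_linear[OF R] by (simp only: linear_add linear_scale)
      ultimately show ?thesis unfolding T by (simp add: algebra_simps)
    qed
    then show "convex_fun (u \<circ> T)"
      using coercive_convexD(1)[OF u] by (auto simp: convex_fun_def)
  qed (use coercive_convexD(2)[OF u] in auto)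
  ultimately have "level_V1 t (u \<circ> T) = enn2real (perimeter1 (closure (sublevel t (u \<circ> T)))) / 2"
    using intrinsic_volume1_eq_perimeter1 by (simp add: level_V1_def sublevel_def)
  also have "perimeter1 (closure (sublevel t (u \<circ> T))) = perimeter1 (closure (sublevel t u))"
    unfolding cl using perimeter1_similarity[OF closed_closure zero_less_one f surj] by simp
  finally show "level_V1 t (u \<circ> T) = level_V1 t u" unfolding level_V1_eq_perimeter1[OF u] .
qed

text \<open>Every point of \<open>W\<close> lies in a box whose finitely many corners, and therefore the box, are
  contained in one of the sets.\<close>

lemma compact_subset_increasing_convex:
  fixes S :: "nat \<Rightarrow> 'a::euclidean_space set"
  assumes cv: "\<And>i. convex (S i)" and inc: "incseq S" and W: "open W" "W \<subseteq> (\<Union>i. S i)"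
    and C: "compact C" "C \<subseteq> W"
  obtains i where "C \<subseteq> S i"
proof -
  have up: "\<exists>i. F \<subseteq> S i" if F: "finite F" "F \<subseteq> (\<Union>i. S i)" for F
    using F
  proof (induction F rule: finite_induct)
    case (insert x F)
    then obtain i j where "F \<subseteq> S i" "x \<in> S j" by auto
    moreover have "S i \<subseteq> S (max i j)" "S j \<subseteq> S (max i j)" by (simp_all add: incseqD[OF inc])
    ultimately have "insert x F \<subseteq> S (max i j)" by blast
    then show ?case by blast
  qed simp
  have "W \<subseteq> (\<Union>i. interior (S i))"
  proof
    fix p assume "p \<in> W"
    then obtain a b where ab: "p \<in> box a b" "cbox a b \<subseteq> W"
      using W(1) open_contains_cbox by metis
    obtain F where F: "finite F" "cbox a b = convex hull F" by (rule closed_interval_as_convex_hull)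
    have "F \<subseteq> W" using ab(2) F(2) hull_subset[of F convex] by blast
    then have "F \<subseteq> (\<Union>i. S i)" using W(2) by blast
    then obtain i where "F \<subseteq> S i" using up[OF F(1)] by blast
    then have "cbox a b \<subseteq> S i" unfolding F(2) by (intro hull_minimal cv)
    then have "box a b \<subseteq> interior (S i)" using box_subset_cbox by (intro interior_maximal) auto
    then show "p \<in> (\<Union>i. interior (S i))" using ab(1) by blast
  qed
  then have "C \<subseteq> (\<Union>i\<in>UNIV. interior (S i))" using C(2) by blast
  then obtain D where D: "finite D" "C \<subseteq> (\<Union>i\<in>D. interior (S i))"
    by (rule compactE_image[OF C(1) open_interior])
  have "C \<subseteq> S (Max (insert 0 D))"
  proof
    fix p assume "p \<in> C"
    then obtain i where i: "i \<in> D" "p \<in> S i" using D(2) interior_subset by blast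
    have "S i \<subseteq> S (Max (insert 0 D))" using i(1) D(1) by (intro incseqD[OF inc]) auto
    then show "p \<in> S (Max (insert 0 D))" using i(2) by blast
  qed
  then show ?thesis by (rule that)
qed

section \<open>Decreasing sequences and m-continuity\<close>

text \<open>A second point of the domain would, by convexity, keep \<open>u\<close> below
  \<open>t\<close> on a nontrivial interval; the term \<open>\<bar>y\<bar>\<close> in
  \<open>hat\<close> then leaves vertical room, and the sublevel set would have interior.\<close>

lemma thin_sublevel_eff_dom:
  assumes u: "convex_fun u" "\<And>x. u x \<noteq> -\<infinity>"
    and thin: "interior (sublevel t u) = {}" and x0: "u x0 < ereal t"
  shows "eff_dom u = {x0}"
proof -
  have "x1 = x0" if x1: "u x1 < \<infinity>" for x1
  proof (rule ccontr)
    assume "x1 \<noteq> x0"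
    have z: "(x0, 0) \<in> sublevel t u" using x0 by (simp add: mem_sublevel)
    obtain s where s: "s < t" "(x0, 0) \<in> closed_sublevel s u" using sublevel_shrink[OF z] .
    obtain r where "u x1 = ereal r" using x1 u(2)[of x1] by (cases "u x1") auto
    then have r: "(x1, 0) \<in> closed_sublevel r u" by (simp add: mem_closed_sublevel)
    define d where "d = \<bar>r - s\<bar> + 1"
    have d: "0 < d" by (simp add: d_def)
    \<comment> \<open>A step towards \<open>x1\<close> so short that the interpolated value stays
      below \<open>t\<close>; the \<open>+ 1\<close> in \<open>d\<close> excludes division by
      0.\<close>
    define l where "l = min 1 ((t - s) / (2 * d))"
    have l: "0 < l" "l \<le> 1" using s(1) d by (auto simp: l_def)
    have "l * \<bar>r - s\<bar> < t - s"
    proof -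
      have "l * \<bar>r - s\<bar> \<le> l * d" using l by (intro mult_left_mono) (auto simp: d_def)
      also have "\<dots> \<le> (t - s) / (2 * d) * d"
        using d by (intro mult_right_mono) (auto simp: l_def)
      also have "\<dots> = (t - s) / 2" using d by simp
      finally show ?thesis using s(1) by simp
    qed
    moreover have "l * (r - s) \<le> l * \<bar>r - s\<bar>" using l by (intro mult_left_mono) auto
    ultimately have lt: "(1 - l) * s + l * r < t" by (simp add: algebra_simps)
    define x2 where "x2 = (1 - l) * x0 + l * x1"
    have "(1 - l) *\<^sub>R (x0, 0 :: real) + l *\<^sub>R (x1, 0) \<in> closed_sublevel ((1 - l) * s + l * r) u"
      using l by (intro hat_convex_bound[OF u s(2) r]) auto
    then have x2: "(x2, 0) \<in> sublevel t u" using closed_sublevel_mono[OF lt] by (auto simp: x2_def)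
    have x20: "x2 \<noteq> x0" using l \<open>x1 \<noteq> x0\<close> by (simp add: x2_def algebra_simps)
    \<comment> \<open>Around \<open>(x3, 0)\<close> there are points of the set to the left, right,
      above and below. A supporting functional there must vanish in both coordinates, so the point
      is interior.\<close>
    define x3 where "x3 = (x0 + x2) / 2"
    have "(1/2) *\<^sub>R (x0, 0) + (1/2) *\<^sub>R (x2, 0) \<in> sublevel t u"
      using convexD[OF convex_sublevel[OF u] z x2, of "1/2" "1/2"] by simp
    then have x3: "(x3, 0) \<in> sublevel t u" by (simp add: x3_def add_divide_distrib)
    obtain s' where s': "s' < t" "(x3, 0) \<in> closed_sublevel s' u" using sublevel_shrink[OF x3] .
    define e where "e = (t - s') / 2"
    have e: "0 < e" using s' by (simp add: e_def)
    have "u x3 \<le> ereal s'" using s'(2) by (simp add: mem_closed_sublevel)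
    also have "ereal s' < ereal (t - e)" using s'(1) by (simp add: e_def field_simps)
    finally have x3e: "(x3, e) \<in> sublevel t u" "(x3, - e) \<in> sublevel t u"
      using e by (auto simp: mem_sublevel)
    obtain a where a: "a \<noteq> 0" "\<And>y. y \<in> sublevel t u \<Longrightarrow> a \<bullet> y \<le> a \<bullet> (x3, 0)"
      using supporting_functional[OF convex_sublevel[OF u] x3] thin by blast
    obtain a1 a2 where a12: "a = (a1, a2)" by (cases a)
    have "a2 * e \<le> 0" "0 \<le> a2 * e" using a(2)[OF x3e(1)] a(2)[OF x3e(2)] by (auto simp: a12)
    then have "a2 = 0" using e by auto
    moreover have "a1 * (x0 - x2) \<le> 0" "0 \<le> a1 * (x0 - x2)"
      using a(2)[OF z] a(2)[OF x2] by (auto simp: a12 x3_def algebra_simps)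
    then have "a1 = 0" using x20 by auto
    ultimately show False using a(1) by (simp add: a12 zero_prod_def)
  qed
  then show ?thesis using x0 by (auto simp: eff_dom_def)
qed

text \<open>Locates the open body over the region where pointwise convergence is assumed: the
  projection of an open set is open.\<close>

lemma sublevel_interior_rel_interior:
  assumes "p \<in> interior (sublevel t u)"
  shows "fst p \<in> rel_interior (eff_dom u)"
proof -
  have "open (fst ` interior (sublevel t u))" by (intro open_image_fst open_interior)
  moreover have "fst ` sublevel t u \<subseteq> eff_dom u"
  proof (rule image_subsetI)
    fix p assume "p \<in> sublevel t u"
    moreover obtain x y where p: "p = (x, y)" by (cases p)
    ultimately have "u x < ereal (t - \<bar>y\<bar>)" by (simp add: mem_sublevel)
    also have "\<dots> < \<infinity>" by simp
    finally show "fst p \<in> eff_dom u" by (simp add: p eff_dom_def)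
  qed
  then have "fst ` interior (sublevel t u) \<subseteq> eff_dom u" using interior_subset by fast
  ultimately have "fst ` interior (sublevel t u) \<subseteq> interior (eff_dom u)" by (intro interior_maximal)
  then show ?thesis using assms interior_subset_rel_interior by blast
qed

text \<open>A body with interior is shrunk towards an interior point; the compact copy lies in the
  open interior, which the increasing convex sets \<open>sublevel t (U i)\<close> exhaust. A thin
  body is a vertical segment over the only point of the domain, and convergence at that point
  suffices.\<close>

lemma shrunk_sublevel_absorbed:
  assumes u: "u \<in> coercive_convex" and U: "\<And>i. U i \<in> coercive_convex"
    and dec: "\<And>i x. U (Suc i) x \<le> U i x"
    and lim: "\<And>x. x \<in> rel_interior (eff_dom u) \<Longrightarrow> (\<lambda>i. U i x) \<longlonglongrightarrow> u x"
    and ne: "sublevel t u \<noteq> {}" and e: "0 < e" "e < 1"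
  obtains z i where "(\<lambda>p. e *\<^sub>R z + (1 - e) *\<^sub>R p) ` closure (sublevel t u) \<subseteq> sublevel t (U i)"
proof (cases "interior (sublevel t u) = {}")
  case False
  then obtain z where z: "z \<in> interior (sublevel t u)" by blast
  let ?C = "(\<lambda>p. e *\<^sub>R z + (1 - e) *\<^sub>R p) ` closure (sublevel t u)"
  have sub: "?C \<subseteq> interior (sublevel t u)"
  proof (rule image_subsetI)
    fix p assume "p \<in> closure (sublevel t u)"
    then have "p - e *\<^sub>R (p - z) \<in> interior (sublevel t u)"
      using e by (intro mem_interior_closure_convex_shrink convex_sublevel coercive_convexD[OF u] z) auto
    then show "e *\<^sub>R z + (1 - e) *\<^sub>R p \<in> interior (sublevel t u)" by (simp add: algebra_simps)
  qed
  have cpt: "compact ?C" by (intro compact_affinity compact_closure_sublevel u)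
  have cover: "interior (sublevel t u) \<subseteq> (\<Union>i. sublevel t (U i))"
  proof
    fix p assume p: "p \<in> interior (sublevel t u)"
    obtain x y where xy: "p = (x, y)" by (cases p)
    have "(\<lambda>i. U i x) \<longlonglongrightarrow> u x"
      using lim sublevel_interior_rel_interior[OF p] by (simp add: xy)
    moreover have "u x < ereal (t - \<bar>y\<bar>)" using p interior_subset by (auto simp: xy mem_sublevel[symmetric])
    ultimately have "eventually (\<lambda>i. U i x < ereal (t - \<bar>y\<bar>)) sequentially" by (rule order_tendstoD)
    then obtain i where "U i x < ereal (t - \<bar>y\<bar>)" by (auto simp: eventually_sequentially)
    then show "p \<in> (\<Union>i. sublevel t (U i))" by (auto simp: xy mem_sublevel)
  qed
  have inc: "incseq (\<lambda>i. sublevel t (U i))" by (intro incseq_SucI sublevel_antimono dec)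
  have cv: "convex (sublevel t (U i))" for i
    by (intro convex_sublevel coercive_convexD[OF U])
  obtain i where "?C \<subseteq> sublevel t (U i)"
    by (rule compact_subset_increasing_convex[OF cv inc open_interior cover cpt sub])
  then show ?thesis by (rule that)
next
  case True
  obtain x0 y0 where "(x0, y0) \<in> sublevel t u" using ne by auto
  then have "u x0 < ereal (t - \<bar>y0\<bar>)" by (simp add: mem_sublevel)
  also have "\<dots> \<le> ereal t" by simp
  finally have x0: "u x0 < ereal t" .
  have dom: "eff_dom u = {x0}"
    by (rule thin_sublevel_eff_dom[OF coercive_convexD(1,2)[OF u] True x0])
  obtain s where s: "u x0 = ereal s" "s < t"
    using x0 coercive_convexD(2)[OF u, of x0] by (cases "u x0") auto
  have "(\<lambda>i. U i x0) \<longlonglongrightarrow> ereal s" using lim[of x0] by (simp add: dom s(1))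
  \<comment> \<open>The segment has half-height \<open>t - s\<close>, its shrunk copy
    \<open>(1 - e) * (t - s)\<close>; the threshold that \<open>U i x0\<close> must pass exceeds the
    limit \<open>s\<close> by \<open>e * (t - s)\<close>.\<close>
  moreover have "ereal s < ereal (t - (1 - e) * (t - s))"
  proof -
    have "t - (1 - e) * (t - s) - s = e * (t - s)" by (simp add: algebra_simps)
    also have "\<dots> > 0" using e s(2) by simp
    finally show ?thesis by simp
  qed
  ultimately have "eventually (\<lambda>i. U i x0 < ereal (t - (1 - e) * (t - s))) sequentially"
    by (rule order_tendstoD)
  then obtain i where i: "U i x0 < ereal (t - (1 - e) * (t - s))" by (auto simp: eventually_sequentially)
  have "(\<lambda>p. e *\<^sub>R (x0, 0) + (1 - e) *\<^sub>R p) ` closure (sublevel t u) \<subseteq> sublevel t (U i)"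
    unfolding closure_sublevel[OF u ne]
  proof (rule image_subsetI)
    fix p assume "p \<in> closed_sublevel t u"
    moreover obtain x y where p: "p = (x, y)" by (cases p)
    ultimately have le: "u x \<le> ereal (t - \<bar>y\<bar>)" by (simp add: mem_closed_sublevel)
    have "x \<in> eff_dom u" using le_less_trans[OF le, of \<infinity>] by (simp add: eff_dom_def)
    then have x: "x = x0" using dom by simp
    then have "\<bar>y\<bar> \<le> t - s" using le s by simp
    then have "\<bar>(1 - e) * y\<bar> \<le> (1 - e) * (t - s)" using e by (simp add: abs_mult)
    then have "ereal (t - (1 - e) * (t - s)) \<le> ereal (t - \<bar>(1 - e) * y\<bar>)" by simp
    with i have "U i x0 < ereal (t - \<bar>(1 - e) * y\<bar>)" by (rule less_le_trans)
    moreover have "e *\<^sub>R (x0, 0) + (1 - e) *\<^sub>R p = (x0, (1 - e) * y)"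
      by (simp add: p x algebra_simps)
    ultimately show "e *\<^sub>R (x0, 0) + (1 - e) *\<^sub>R p \<in> sublevel t (U i)"
      by (simp only: mem_sublevel)
  qed
  then show ?thesis by (rule that)
qed

lemma m_continuous_level_V1: "m_continuous (level_V1 t)"
  unfolding m_continuous_def
proof (intro ballI allI impI)
  fix u :: "real \<Rightarrow> ereal" and U :: "nat \<Rightarrow> real \<Rightarrow> ereal"
  assume u: "u \<in> coercive_convex" and "\<forall>i. U i \<in> coercive_convex"
    and dec: "\<forall>i x. U i x \<ge> U (Suc i) x \<and> U (Suc i) x \<ge> u x"
    and lim: "\<forall>x\<in>rel_interior (eff_dom u). (\<lambda>i. U i x) \<longlonglongrightarrow> u x"
  then have U: "U i \<in> coercive_convex" for i by blast
  have uU: "u x \<le> U i x" for i x using dec order_trans by blast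
  have UU: "U (Suc i) x \<le> U i x" for i x using dec by blast
  define P where "P w = enn2real (perimeter1 (closure (sublevel t w)))" for w
  have P0: "0 \<le> P w" for w by (simp add: P_def)
  have Pmono: "P v \<le> P w"
    if "v \<in> coercive_convex" "w \<in> coercive_convex" "\<And>x. w x \<le> v x" for v w
    unfolding P_def using that
    by (intro enn2real_mono perimeter1_mono perimeter1_sublevel_finite compact_closure_sublevel
        convex_closure_sublevel closure_mono sublevel_antimono)
  \<comment> \<open>A single index is enough because \<open>P (U i)\<close> increases with
    \<open>i\<close>.\<close>
  have low: "\<exists>i. (1 - e) * P u \<le> P (U i)" if e: "0 < e" "e < 1" for e
  proof (cases "sublevel t u = {}")
    case False
    obtain z i where zi: "(\<lambda>p. e *\<^sub>R z + (1 - e) *\<^sub>R p) ` closure (sublevel t u) \<subseteq> sublevel t (U i)"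
      by (rule shrunk_sublevel_absorbed[of u U, OF u U UU lim[rule_format] False e])
    let ?f = "\<lambda>p. e *\<^sub>R z + (1 - e) *\<^sub>R p"
    have f: "dist (?f p) (?f q) = (1 - e) * dist p q" for p q
      using e by (simp add: dist_norm flip: scaleR_diff_right)
    have surj: "surj ?f"
      by (rule surjI[of _ "\<lambda>p. (1 / (1 - e)) *\<^sub>R (p - e *\<^sub>R z)"]) (use e in simp)
    have e1: "0 < 1 - e" using e by simp
    have "perimeter1 (?f ` closure (sublevel t u)) \<le> perimeter1 (closure (sublevel t (U i)))"
      using zi closure_subset[of "sublevel t (U i)"]
      by (intro perimeter1_mono compact_affinity convex_affinity compact_closure_sublevel
          convex_closure_sublevel u U) blast
    then have "ennreal (1 - e) * perimeter1 (closure (sublevel t u)) \<le> perimeter1 (closure (sublevel t (U i)))"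
      by (simp only: perimeter1_similarity[OF closed_closure e1 f surj])
    then have "enn2real (ennreal (1 - e) * perimeter1 (closure (sublevel t u))) \<le> P (U i)"
      unfolding P_def by (intro enn2real_mono perimeter1_sublevel_finite U)
    then show ?thesis using e1 by (auto simp: enn2real_mult P_def)
  qed (simp add: P_def)
  have "(\<lambda>i. P (U i)) \<longlonglongrightarrow> P u"
  proof (rule order_tendstoI)
    fix a assume a: "a < P u"
    have "\<exists>i. a < P (U i)"
    proof (cases "a < 0")
      case True
      then show ?thesis using P0 less_le_trans by blast
    next
      case False
      \<comment> \<open>Makes \<open>(1 - e) * P u\<close> the midpoint of \<open>a\<close> and
        \<open>P u\<close>. Negative \<open>a\<close> has been split off, so the denominator is
        positive.\<close>
      define e where "e = (P u - a) / (2 * P u)"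
      have Pu: "0 < P u" using a False by simp
      have e: "0 < e" "e < 1" using a False Pu by (auto simp: e_def field_simps)
      have "(1 - e) * P u = (P u + a) / 2" using Pu by (simp add: e_def field_simps)
      moreover obtain i where "(1 - e) * P u \<le> P (U i)" using low[OF e] by blast
      moreover have "a < (P u + a) / 2" using a by simp
      ultimately have "a < P (U i)" by (metis less_le_trans)
      then show ?thesis by blast
    qed
    then obtain i where i: "a < P (U i)" by blast
    have "P (U i) \<le> P (U j)" if "i \<le> j" for j
      using that
    proof (induction j rule: dec_induct)
      case (step j)
      then show ?case using Pmono[OF U[of j] U[of "Suc j"] UU] by simp
    qed simp
    then have "a < P (U j)" if "i \<le> j" for j using that i by (meson less_le_trans)
    then show "eventually (\<lambda>i. a < P (U i)) sequentially" by (auto simp: eventually_sequentially)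
  next
    fix a assume "P u < a"
    then show "eventually (\<lambda>i. P (U i) < a) sequentially"
      using Pmono[OF U u uU] le_less_trans by (intro always_eventually) blast
  qed
  then have "(\<lambda>i. P (U i) / 2) \<longlonglongrightarrow> P u / 2" by (intro tendsto_divide) auto
  then show "(\<lambda>i. level_V1 t (U i)) \<longlonglongrightarrow> level_V1 t u"
    by (simp add: level_V1_eq_perimeter1 u U P_def)
qed

section \<open>Failure of homogeneous decomposability\<close>

lemma tent_coercive_convex:
  fixes l c :: real
  assumes l: "0 < l"
  shows "(\<lambda>x. ereal (\<bar>x / l\<bar> + c)) \<in> coercive_convex"
proof -
  have "convex_fun (\<lambda>x. ereal (\<bar>x / l\<bar> + c))"
    unfolding convex_fun_def
  proof (intro allI impI)
    fix x y a b :: real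
    assume ab: "0 \<le> a" "0 \<le> b" "a + b = 1"
    have "\<bar>(a * x + b * y) / l\<bar> \<le> a * \<bar>x / l\<bar> + b * \<bar>y / l\<bar>"
      using abs_triangle_ineq[of "a * (x / l)" "b * (y / l)"] ab
      by (simp add: abs_mult add_divide_distrib)
    moreover have "c = a * c + b * c" using ab by (simp flip: distrib_right)
    ultimately show "ereal (\<bar>(a *\<^sub>R x + b *\<^sub>R y) / l\<bar> + c)
        \<le> ereal a * ereal (\<bar>x / l\<bar> + c) + ereal b * ereal (\<bar>y / l\<bar> + c)"
      by (simp add: distrib_left)
  qed
  moreover have "lower_semicontinuous (\<lambda>x. ereal (\<bar>x / l\<bar> + c))"
    unfolding lower_semicontinuous_def
  proof
    fix x :: real
    have "((\<lambda>x. ereal (\<bar>x / l\<bar> + c)) \<longlongrightarrow> ereal (\<bar>x / l\<bar> + c)) (at x)"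
      using l by (intro tendsto_intros) auto
    then show "ereal (\<bar>x / l\<bar> + c) \<le> Liminf (at x) (\<lambda>x. ereal (\<bar>x / l\<bar> + c))"
      by (intro eq_refl lim_imp_Liminf[symmetric]) auto
  qed
  moreover have "((\<lambda>x. ereal (\<bar>x / l\<bar> + c)) \<longlongrightarrow> \<infinity>) at_infinity"
    unfolding tendsto_PInfty eventually_at_infinity
  proof (intro allI exI impI)
    fix r x :: real
    assume "(\<bar>r - c\<bar> + 1) * l \<le> norm x"
    then have "\<bar>r - c\<bar> + 1 \<le> \<bar>x / l\<bar>" using l by (simp add: pos_le_divide_eq)
    then show "ereal r < ereal (\<bar>x / l\<bar> + c)" by simp
  qed
  ultimately show ?thesis by (simp add: coercive_convex_def)
qed

text \<open>The shift by \<open>t - 1\<close> makes the body the same for every \<open>t\<close>: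
  the rhombus with vertices \<open>(l, 0)\<close>, \<open>(0, 1)\<close>, \<open>(- l, 0)\<close>,
  \<open>(0, - 1)\<close> and four sides of length \<open>sqrt (1 + l * l)\<close>.\<close>

lemma level_V1_tent:
  assumes l: "0 < l"
  shows "level_V1 t (\<lambda>x. ereal (\<bar>x / l\<bar> + (t - 1))) = 2 * sqrt (1 + l\<^sup>2)"
proof -
  define u where "u = (\<lambda>x. ereal (\<bar>x / l\<bar> + (t - 1)))"
  have u: "u \<in> coercive_convex" unfolding u_def by (rule tent_coercive_convex[OF l])
  have S: "sublevel t u = {p. \<bar>fst p / l\<bar> + \<bar>snd p\<bar> < 1}"
    by (auto simp: mem_sublevel u_def)
  have Q: "closed_sublevel t u = {p. \<bar>fst p / l\<bar> + \<bar>snd p\<bar> \<le> 1}"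
    by (auto simp: mem_closed_sublevel u_def)
  have "(0, 0) \<in> sublevel t u" by (simp add: S)
  then have ne: "sublevel t u \<noteq> {}" by blast
  have op: "interior (sublevel t u) = sublevel t u"
    unfolding S using l by (intro interior_open open_Collect_less continuous_intros) auto
  have int: "interior (closure (sublevel t u)) = sublevel t u"
    using convex_interior_closure[OF convex_sublevel[OF coercive_convexD(1,2)[OF u]]] op by simp
  define p q r s where "p = (l, 0 :: real)" and "q = (0 :: real, 1 :: real)"
    and "r = (- l, 0 :: real)" and "s = (0 :: real, - 1 :: real)"
  \<comment> \<open>The signs treat all four sides at once; each is its own inverse, so multiplying
    by it again cancels it.\<close>
  have edge: "z \<in> closed_segment (\<sigma> * l, 0) (0, \<tau>) \<longleftrightarrow>
      0 \<le> \<sigma> * fst z \<and> 0 \<le> \<tau> * snd z \<and> \<bar>fst z / l\<bar> + \<bar>snd z\<bar> = 1"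
    if "\<sigma> \<in> {1, -1}" "\<tau> \<in> {1, -1}" for \<sigma> \<tau> :: real and z :: "real \<times> real"
  proof
    assume "z \<in> closed_segment (\<sigma> * l, 0) (0, \<tau>)"
    then obtain v where v: "0 \<le> v" "v \<le> 1" "z = ((1 - v) * (\<sigma> * l), v * \<tau>)" by (auto simp: in_segment)
    then show "0 \<le> \<sigma> * fst z \<and> 0 \<le> \<tau> * snd z \<and> \<bar>fst z / l\<bar> + \<bar>snd z\<bar> = 1"
      using that l by (auto simp: abs_mult)
  next
    assume z: "0 \<le> \<sigma> * fst z \<and> 0 \<le> \<tau> * snd z \<and> \<bar>fst z / l\<bar> + \<bar>snd z\<bar> = 1"
    obtain x y where xy: "z = (x, y)" by (cases z)
    have y: "\<bar>y\<bar> = \<tau> * y" and x: "\<bar>x / l\<bar> = \<sigma> * x / l" using z that l by (auto simp: xy)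
    have "0 \<le> \<bar>x / l\<bar>" by simp
    then have "\<tau> * y \<le> 1" using z y unfolding xy fst_conv snd_conv by linarith
    moreover have "x = (1 - \<tau> * y) * (\<sigma> * l)"
    proof -
      have "\<sigma> * x / l = 1 - \<tau> * y" using z x y unfolding xy fst_conv snd_conv by linarith
      then have "\<sigma> * x = (1 - \<tau> * y) * l" using l by (simp add: divide_eq_eq)
      then have "\<sigma> * (\<sigma> * x) = \<sigma> * ((1 - \<tau> * y) * l)" by simp
      then show ?thesis using that by auto
    qed
    moreover have "y = (\<tau> * y) * \<tau>" using that by auto
    ultimately show "z \<in> closed_segment (\<sigma> * l, 0) (0, \<tau>)"
      using z unfolding in_segment xy by (intro exI[of _ "\<tau> * y"]) auto
  qed
  have e1: "z \<in> closed_segment p q \<longleftrightarrow> 0 \<le> fst z \<and> 0 \<le> snd z \<and> \<bar>fst z / l\<bar> + \<bar>snd z\<bar> = 1"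
    and e2: "z \<in> closed_segment r q \<longleftrightarrow> fst z \<le> 0 \<and> 0 \<le> snd z \<and> \<bar>fst z / l\<bar> + \<bar>snd z\<bar> = 1"
    and e3: "z \<in> closed_segment r s \<longleftrightarrow> fst z \<le> 0 \<and> snd z \<le> 0 \<and> \<bar>fst z / l\<bar> + \<bar>snd z\<bar> = 1"
    and e4: "z \<in> closed_segment p s \<longleftrightarrow> 0 \<le> fst z \<and> snd z \<le> 0 \<and> \<bar>fst z / l\<bar> + \<bar>snd z\<bar> = 1" for z
    using edge[of 1 1 z] edge[of "-1" 1 z] edge[of "-1" "-1" z] edge[of 1 "-1" z]
    by (simp_all add: p_def q_def r_def s_def)
  have fr: "frontier (closure (sublevel t u))
      = (closed_segment p q \<union> closed_segment r q) \<union> (closed_segment r s \<union> closed_segment p s)"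
  proof -
    have "frontier (closure (sublevel t u)) = closed_sublevel t u - sublevel t u"
      by (simp add: frontier_def int closure_sublevel[OF u ne, symmetric])
    also have "\<dots> = {z. \<bar>fst z / l\<bar> + \<bar>snd z\<bar> = 1}" unfolding S Q by auto
    also have "\<dots> = (closed_segment p q \<union> closed_segment r q) \<union> (closed_segment r s \<union> closed_segment p s)"
      unfolding set_eq_iff Un_iff e1 e2 e3 e4 mem_Collect_eq by (meson linear)
    finally show ?thesis .
  qed
  let ?H = hausdorff_measure1 and ?c = "ennreal (sqrt (1 + l\<^sup>2))"
  have len: "?H (closed_segment p q) = ?c" "?H (closed_segment r q) = ?c"
    "?H (closed_segment r s) = ?c" "?H (closed_segment p s) = ?c"
    by (simp_all add: hausdorff_measure1_segment p_def q_def r_def s_def dist_Pair_Pair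
        dist_real_def add.commute)
  \<comment> \<open>Pieces that share only finitely many vertices add up, since finite sets are
    null.\<close>
  have add: "?H (A \<union> B) = ?H A + ?H B" if "closed A" "A \<inter> B \<subseteq> F" "finite F" for A B F
    using hausdorff_measure1_modular[OF that(1), of B] hausdorff_measure1_finite[OF finite_subset[OF that(2,3)]]
    by simp
  have upper: "?H (closed_segment p q \<union> closed_segment r q) = ?c + ?c"
  proof (subst add[of _ _ "{q}"])
    show "closed_segment p q \<inter> closed_segment r q \<subseteq> {q}"
    proof
      fix z assume "z \<in> closed_segment p q \<inter> closed_segment r q"
      then show "z \<in> {q}" unfolding Int_iff e1 e2 by (cases z) (auto simp: q_def)
    qed
  qed (simp_all add: len)
  have lower: "?H (closed_segment r s \<union> closed_segment p s) = ?c + ?c"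
  proof (subst add[of _ _ "{s}"])
    show "closed_segment r s \<inter> closed_segment p s \<subseteq> {s}"
    proof
      fix z assume "z \<in> closed_segment r s \<inter> closed_segment p s"
      then show "z \<in> {s}" unfolding Int_iff e3 e4 by (cases z) (auto simp: s_def)
    qed
  qed (simp_all add: len)
  have "?H (frontier (closure (sublevel t u)))
      = ?H (closed_segment p q \<union> closed_segment r q) + ?H (closed_segment r s \<union> closed_segment p s)"
    unfolding fr
  proof (rule add[of _ _ "{p, r}"])
    show "(closed_segment p q \<union> closed_segment r q) \<inter> (closed_segment r s \<union> closed_segment p s) \<subseteq> {p, r}"
    proof
      fix z assume "z \<in> (closed_segment p q \<union> closed_segment r q) \<inter> (closed_segment r s \<union> closed_segment p s)"
      then have z: "snd z = 0" "\<bar>fst z / l\<bar> + \<bar>snd z\<bar> = 1" unfolding Int_iff Un_iff e1 e2 e3 e4 by auto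
      then have "\<bar>fst z\<bar> = l" using l by simp
      then show "z \<in> {p, r}" using z(1) by (cases z) (auto simp: p_def r_def abs_if split: if_splits)
    qed
  qed (auto intro: closed_Un)
  also have "\<dots> = (?c + ?c) + (?c + ?c)" by (simp only: upper lower)
  also have "\<dots> = ennreal (4 * sqrt (1 + l\<^sup>2))" by (simp flip: ennreal_plus)
  finally have "perimeter1 (closure (sublevel t u)) = ennreal (4 * sqrt (1 + l\<^sup>2))"
    using ne by (simp add: perimeter1_def int)
  then show ?thesis using level_V1_eq_perimeter1[OF u, of t] by (simp add: u_def)
qed

text \<open>A finite sum of exponentials extends to an entire function whose square would be
  \<open>4 (1 + exp (2 z))\<close>. But this function has simple zeros, for instance at \<open>\<i> \<pi> / 2\<close>.\<close>

lemma sqrt_not_exponential_sum: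
  fixes c \<alpha> :: "nat \<Rightarrow> real"
  shows "\<exists>s. 2 * sqrt (1 + (exp s)\<^sup>2) \<noteq> (\<Sum>i<m. c i * exp (\<alpha> i * s))"
proof (rule ccontr)
  assume "\<not> ?thesis"
  then have eq: "2 * sqrt (1 + (exp s)\<^sup>2) = (\<Sum>i<m. c i * exp (\<alpha> i * s))" for s by simp
  define f where "f z = (\<Sum>i<m. of_real (c i) * exp (of_real (\<alpha> i) * z))" for z :: complex
  define f' where "f' z = (\<Sum>i<m. of_real (c i) * (exp (of_real (\<alpha> i) * z) * of_real (\<alpha> i)))" for z :: complex
  have df: "(f has_field_derivative f' z) (at z)" for z
    unfolding f_def f'_def by (auto intro!: derivative_eq_intros sum.cong)
  have hol: "(\<lambda>z. (f z)\<^sup>2 - 4 * (1 + exp (2 * z))) holomorphic_on UNIV"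
    unfolding f_def by (intro holomorphic_intros)
  \<comment> \<open>True on the real axis, which accumulates at 0; the identity theorem does the
    rest.\<close>
  have zero: "(f z)\<^sup>2 - 4 * (1 + exp (2 * z)) = 0" for z
  proof (rule analytic_continuation[OF hol])
    show "(0 :: complex) islimpt \<real>"
      unfolding islimpt_approachable
    proof (intro allI impI)
      fix e :: real assume "0 < e"
      then show "\<exists>x'\<in>\<real>. x' \<noteq> 0 \<and> dist x' (0 :: complex) < e"
        by (intro bexI[of _ "of_real (e / 2)"]) auto
    qed
    fix w :: complex assume "w \<in> \<real>"
    then obtain x where w: "w = of_real x" by (auto elim: Reals_cases)
    have "f w = of_real (2 * sqrt (1 + (exp x)\<^sup>2))"
      unfolding eq f_def w by (simp add: exp_of_real flip: of_real_mult)
    then have "(f w)\<^sup>2 = of_real ((2 * sqrt (1 + (exp x)\<^sup>2))\<^sup>2)" by (simp flip: of_real_power)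
    also have "(2 * sqrt (1 + (exp x)\<^sup>2))\<^sup>2 = 4 * (1 + (exp x)\<^sup>2)"
      by (simp add: power_mult_distrib)
    also have "(exp x)\<^sup>2 = exp (2 * x)" by (rule exp_double[symmetric])
    also have "of_real (4 * (1 + exp (2 * x))) = 4 * (1 + exp (2 * w))"
      by (simp add: w exp_of_real[symmetric])
    finally show "(f w)\<^sup>2 - 4 * (1 + exp (2 * w)) = 0" by simp
  qed auto
  define a where "a = \<i> * of_real pi / 2"
  have ea: "exp (2 * a) = - 1" by (simp add: a_def mult.commute)
  then have fa: "f a = 0" using zero[of a] by simp
  \<comment> \<open>At the zero \<open>a\<close> the square has derivative 0, the other side
    \<open>8 * exp (2 * a) = - 8\<close>.\<close>
  have "((\<lambda>z. (f z)\<^sup>2) has_field_derivative 2 * f a * f' a) (at a)"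
    by (auto intro!: derivative_eq_intros df)
  moreover have "((\<lambda>z. 4 * (1 + exp (2 * z))) has_field_derivative 8 * exp (2 * a)) (at a)"
    by (auto intro!: derivative_eq_intros)
  moreover have "(\<lambda>z. (f z)\<^sup>2) = (\<lambda>z. 4 * (1 + exp (2 * z)))" using zero by auto
  ultimately have "2 * f a * f' a = 8 * exp (2 * a)" using DERIV_unique by metis
  then show False by (simp add: fa ea)
qed

text \<open>Dilating by \<open>exp s\<close> turns powers of the factor into exponentials in
  \<open>s\<close>, which are entire for every real exponent, whereas the powers themselves would
  branch at 0.\<close>

lemma level_V1_not_homogeneous_sum:
  fixes m :: nat and F :: "nat \<Rightarrow> (real \<Rightarrow> ereal) \<Rightarrow> real"
  assumes hom: "\<forall>i<m. \<exists>\<alpha>. homogeneous_functional \<alpha> (F i)"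
    and sum: "\<forall>u\<in>coercive_convex. level_V1 t u = (\<Sum>i<m. F i u)"
  shows False
proof -
  obtain \<alpha> where \<alpha>: "\<And>i. i < m \<Longrightarrow> homogeneous_functional (\<alpha> i) (F i)" using hom by metis
  \<comment> \<open>Written with \<open>/ 1\<close> so that \<open>u\<close> is literally the tent
    with \<open>l = 1\<close>.\<close>
  define u where "u = (\<lambda>x :: real. ereal (\<bar>x / 1\<bar> + (t - 1)))"
  have u: "u \<in> coercive_convex" unfolding u_def by (rule tent_coercive_convex) simp
  have "2 * sqrt (1 + (exp s)\<^sup>2) = (\<Sum>i<m. F i u * exp (\<alpha> i * s))" for s
  proof -
    define v where "v = (\<lambda>x. u (x /\<^sub>R exp s))"
    have v: "v = (\<lambda>x. ereal (\<bar>x / exp s\<bar> + (t - 1)))"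
      by (simp add: v_def u_def divide_inverse mult.commute)
    have "2 * sqrt (1 + (exp s)\<^sup>2) = level_V1 t v" unfolding v by (rule level_V1_tent[symmetric]) simp
    also have "\<dots> = (\<Sum>i<m. F i v)"
      using sum tent_coercive_convex[of "exp s" "t - 1"] by (simp add: v)
    also have "\<dots> = (\<Sum>i<m. F i u * exp (\<alpha> i * s))"
    proof (rule sum.cong[OF refl])
      fix i assume "i \<in> {..<m}"
      then have "homogeneous_functional (\<alpha> i) (F i)" using \<alpha> by simp
      then have "F i v = exp s powr \<alpha> i * F i u"
        using u unfolding homogeneous_functional_def v_def by simp
      then show "F i v = F i u * exp (\<alpha> i * s)" by (simp add: powr_def mult.commute)
    qed
    finally show ?thesis .
  qed
  then show False using sqrt_not_exponential_sum[where m = m and c = "\<lambda>i. F i u" and \<alpha> = \<alpha>] by blast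
qed

theorem mainTheorem3:
  fixes t :: real
  shows "valuation (level_V1 t) \<and>
         rigid_motion_invariant (level_V1 t) \<and>
         decreasing_functional (level_V1 t) \<and>
         m_continuous (level_V1 t) \<and>
         \<not> (\<exists>(m::nat) (F :: nat \<Rightarrow> (real \<Rightarrow> ereal) \<Rightarrow> real).
              (\<forall>i<m. \<exists>\<alpha>::real. homogeneous_functional \<alpha> (F i)) \<and>
              (\<forall>u\<in>coercive_convex. level_V1 t u = (\<Sum>i<m. F i u)))"
  using valuation_level_V1 rigid_motion_invariant_level_V1 decreasing_level_V1 m_continuous_level_V1
    level_V1_not_homogeneous_sum by blast

end
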